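(* Let $\widehat M=\begin{pmatrix}\widehat A&\widehat B\\ \widehat C&O\end{pmatrix}\in\mathbb{DC}_z^{n\times n}$, where $\widehat A$ and $\widehat B\widehat C$ are square of the same order and dual Drazin invertible, with $\mathrm{Ind}_s(\widehat A)=i_{\widehat A}$ and $\mathrm{Ind}_s(\widehat B\widehat C)=i_{\widehat B\widehat C}$. Assume $\widehat A\widehat A^\pi\widehat B\widehat C=\widehat B\widehat C\widehat A\widehat A^\pi$ and $\widehat B\widehat C\widehat A\widehat A^e=O$. Then $\widehat M^D=\begin{pmatrix}M_{11}&M_{12}\\ M_{21}&M_{22}\end{pmatrix}$, where, writing $\widehat\Phi=\widehat B\widehat C$ and $s=i_{\widehat B\widehat C}$, $$M_{11}=\sum_{i=0}^{s-1}\widehat A^{(2i+2)D}\widehat\Phi^\pi\widehat\Phi^i\widehat A+\widehat A^D\widehat\Phi^e+\sum_{i=0}^{s-1}\widehat A^{(2i+3)D}\widehat\Phi^\pi\widehat\Phi^{i+1},$$ $$M_{12}=\sum_{i=0}^{s-1}\widehat A^{(2i+2)D}\widehat\Phi^\pi\widehat\Phi^{i}\widehat B+\widehat A^\pi\widehat\Phi^D\widehat B,$$ $$M_{21}=\sum_{i=0}^{s-1}\widehat C\widehat A^{(2i+3)D}\widehat\Phi^\pi\widehat\Phi^i\widehat A-\widehat C\widehat A^{2D}\widehat\Phi^e+\sum_{i=0}^{s-1}\widehat C\widehat A^{(2i+4)D}\widehat\Phi^\pi\widehat\Phi^{i+1}+\widehat C\widehat A^\pi\widehat\Phi^D,$$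 $$M_{22}=\sum_{i=0}^{s-1}\widehat C\widehat A^{(2i+3)D}\widehat\Phi^\pi\widehat\Phi^{i}\widehat B-\widehat C\widehat A\widehat A^\pi\widehat\Phi^{2D}\widehat B-\widehat C\widehat A^D\widehat\Phi^D\widehat B.$$
   Context: Dual numbers: $\varepsilon\neq0$, $\varepsilon^2=0$, commuting with complex matrices. $\mathbb{DC}^{m\times n}$ denotes matrices $\widehat{A}=A+\varepsilon A_0$ with $A,A_0\in\mathbb{C}^{m\times n}$. For complex square $A$, $\mathrm{Ind}(A)$ is the least $k\ge0$ with $\operatorname{rank}A^k=\operatorname{rank}A^{k+1}$ and $A^D$ its Drazin inverse. $\mathbb{DC}_z^{n\times n}$ is the set of $\widehat{A}=A+\varepsilon A_0$ with $(I-AA^D)\big(\sum_{i=1}^{k}A^{k-i}A_0A^{i-1}\big)(I-AA^D)=O$, $k=\mathrm{Ind}(A)$; "dual Drazin invertible" means belonging to this set. For such $\widehat A$, the dual Drazin inverse $\widehat A^D$ is the unique $\widehat X$ with $\widehat A^k\widehat X\widehat A=\widehat A^k$, $\widehat X\widehat A\widehat X=\widehat X$, $\widehat A\widehat X=\widehat X\widehat A$. $\mathrm{Ind}_s(\widehat A):=\mathrm{Ind}(A)$. $\widehat A^{sD}=(\widehat A^D)^s$, $\widehat A^e=\widehat A\widehat A^D$, $\widehat A^\pi=I-\widehat A^e$, $\widehat A^0=I$; empty sums are zero.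
   Formalization: The second term of M_11 is taken as −A^D Φ^e instead of the printed +A^D Φ^e; with the plus sign the formula fails, e.g. for A=(1 1; 0 0), B=(0; 1), C=(0 1). *)

theory Defs
  imports Complex_Main "Jordan_Normal_Form.DL_Rank"
begin

text \<open>Dual numbers \<open>a + \<epsilon> b\<close> over a commutative ring. A dual complex matrix \<open>A + \<epsilon> A\<^sub>0\<close> is a
  \<^typ>\<open>'a mat\<close> whose entries are dual complex numbers.\<close>

datatype 'a dual_number = Dual (std_part: 'a) (inf_part: 'a)

instantiation dual_number :: (comm_ring_1) comm_ring_1
begin

definition "0 = Dual 0 0"
definition "1 = Dual 1 0"
definition "x + y = Dual (std_part x + std_part y) (inf_part x + inf_part y)"
definition "x - y = Dual (std_part x - std_part y) (inf_part x - inf_part y)"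
definition "- x = Dual (- std_part x) (- inf_part x)"
definition "x * y = Dual (std_part x * std_part y)
  (std_part x * inf_part y + inf_part x * std_part y)"

instance
  by standard
    (auto simp: zero_dual_number_def one_dual_number_def plus_dual_number_def
      minus_dual_number_def uminus_dual_number_def times_dual_number_def algebra_simps
      dual_number.expand)

end

definition dual_eps :: "'a::comm_ring_1 dual_number" where
  "dual_eps = Dual 0 1"

lemma dual_eps_nonzero: "dual_eps \<noteq> (0 :: 'a::comm_ring_1 dual_number)"
  by (simp add: dual_eps_def zero_dual_number_def)

lemma dual_eps_square: "dual_eps * dual_eps = (0 :: 'a::comm_ring_1 dual_number)"
  by (simp add: dual_eps_def zero_dual_number_def times_dual_number_def)

lemma dual_number_decomp:
  "(x :: 'a::comm_ring_1 dual_number) = Dual (std_part x) 0 + dual_eps * Dual (inf_part x) 0"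
  by (simp add: dual_eps_def plus_dual_number_def times_dual_number_def)

type_synonym dc_mat = "complex dual_number mat"

definition std_mat :: "dc_mat \<Rightarrow> complex mat" where
  "std_mat A = map_mat std_part A"

definition inf_mat :: "dc_mat \<Rightarrow> complex mat" where
  "inf_mat A = map_mat inf_part A"

definition mat_sum ::
  "nat \<Rightarrow> nat \<Rightarrow> (nat \<Rightarrow> 'a::comm_monoid_add mat) \<Rightarrow> nat set \<Rightarrow> 'a mat" where
  "mat_sum nr nc F I = mat nr nc (\<lambda>(r, c). \<Sum>i\<in>I. F i $$ (r, c))"

definition mat_ind :: "complex mat \<Rightarrow> nat" where
  "mat_ind A = (LEAST k. vec_space.rank (dim_row A) (A ^\<^sub>m k) =
                         vec_space.rank (dim_row A) (A ^\<^sub>m (k + 1)))"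

definition is_drazin_inverse :: "nat \<Rightarrow> 'a::semiring_1 mat \<Rightarrow> 'a mat \<Rightarrow> bool" where
  "is_drazin_inverse k A X \<longleftrightarrow> X \<in> carrier_mat (dim_row A) (dim_row A) \<and>
     A ^\<^sub>m k * X * A = A ^\<^sub>m k \<and> X * A * X = X \<and> A * X = X * A"

definition drazin :: "complex mat \<Rightarrow> complex mat" where
  "drazin A = (THE X. is_drazin_inverse (mat_ind A) A X)"

definition ind_s :: "dc_mat \<Rightarrow> nat" where
  "ind_s A = mat_ind (std_mat A)"

definition DCz :: "nat \<Rightarrow> dc_mat set" where
  "DCz n = {A \<in> carrier_mat n n.
     let S = std_mat A; S\<^sub>0 = inf_mat A; k = mat_ind S; P = 1\<^sub>m n - S * drazin S
     in P * mat_sum n n (\<lambda>i. S ^\<^sub>m (k - i) * S\<^sub>0 * S ^\<^sub>m (i - 1)) {1..k} * P = 0\<^sub>m n n}"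

text \<open>The description in \<open>ddrazin\<close> is meaningful for \<open>A \<in> DCz n\<close>: such an \<open>A\<close> has exactly one
  dual Drazin inverse.\<close>

definition ddrazin :: "dc_mat \<Rightarrow> dc_mat" where
  "ddrazin A = (THE X. is_drazin_inverse (ind_s A) A X)"

definition ddrazin_pow :: "dc_mat \<Rightarrow> nat \<Rightarrow> dc_mat" where
  "ddrazin_pow A k = ddrazin A ^\<^sub>m k"

definition ddrazin_e :: "dc_mat \<Rightarrow> dc_mat" where
  "ddrazin_e A = A * ddrazin A"

definition ddrazin_pi :: "dc_mat \<Rightarrow> dc_mat" where
  "ddrazin_pi A = 1\<^sub>m (dim_row A) - ddrazin_e A"

open_bundle ddrazin_syntax
begin
notation ddrazin ("_\<^sup>D" [1000] 999)
notation ddrazin_pow ("_\<^bsup>_ D\<^esup>" [1000, 0] 999)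
notation ddrazin_e ("_\<^sup>e" [1000] 999)
notation ddrazin_pi ("_\<^sup>\<pi>" [1000] 999)
end

text \<open>Sign convention in the theorem: the \<open>(1,1)\<close> block of the inverse contains \<open>- A\<^sup>D \<Phi>\<^sup>e\<close>. The
  source prints \<open>+ A\<^sup>D \<Phi>\<^sup>e\<close> there, which is a misprint: for the complex matrices \<open>A = (1 1; 0 0)\<close>,
  \<open>B = (0; 1)\<close>, \<open>C = (0 1)\<close> all hypotheses hold, \<open>A\<^sup>D = A\<close>, \<open>\<Phi> = \<Phi>\<^sup>e = (0 0; 0 1)\<close>, and the block
  matrix is invertible; its inverse has \<open>(1,1)\<close> block \<open>(1 0; 0 0) = A\<^sup>D - A\<^sup>D \<Phi>\<^sup>e\<close>, whereas the
  printed formula gives \<open>A\<^sup>D + A\<^sup>D \<Phi>\<^sup>e = (1 2; 0 0)\<close>.\<close>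

end

theory Submission
  imports Defs
begin

text \<open>Write \<open>a\<close>, \<open>\<phi>\<close> for \<open>A\<close>, \<open>\<Phi> = B C\<close> and \<open>d\<close>, \<open>t\<close> for their Drazin inverses, \<open>\<rho> = 1 - a d\<close>,
  \<open>\<psi> = 1 - \<phi> t\<close>, \<open>n = a \<rho>\<close>. The hypotheses give \<open>\<phi> d = 0\<close> and \<open>\<phi> a = n \<phi> = \<phi> n\<close>. The sums
  \<open>S j = (\<Sum>i<s. d\<^bsup>2i+j\<^esup> \<psi> \<phi>\<^sup>i)\<close> satisfy \<open>S j a = d\<^sup>j a\<close> and \<open>S (j+2) \<phi> = S j - d\<^sup>j \<psi>\<close>, so the claimed
  inverse collapses to \<open>X = (S 1, y B; C y, C z B)\<close> with \<open>y = S 2 + \<rho> t\<close> and \<open>z = S 3 - n t\<^sup>2 - d t\<close>,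
  for which \<open>M X = X M\<close> and \<open>X M X = X\<close> are short computations.
  It remains to see that \<open>M\<^sup>j K = 0\<close> for large \<open>j\<close>, where \<open>K = 1 - M X\<close>. The first block row
  \<open>v j\<close> of \<open>M\<^sup>j K\<close> obeys \<open>v (j+2) = a v (j+1) + \<phi> v j\<close>; hence \<open>\<phi> v j\<close> is a combination of terms
  \<open>n\<^sup>\<alpha> \<phi>\<^sup>\<beta> (\<phi> \<psi>)\<close> with \<open>\<alpha> + 2\<beta>\<close> about \<open>j\<close>, which vanish eventually, and then \<open>X K = 0\<close> forces \<open>d v j = 0\<close>,
  so that \<open>v (j+k) = a\<^sup>k v j = 0\<close>.
  Since a Drazin inverse is unique regardless of the index, it suffices that \<open>M\<close> has a dual
  Drazin inverse of index \<open>Ind M\<close>. Such an inverse exists as soon as \<open>M\<^sup>k = M\<^bsup>k+1\<^esup> U = W M\<^bsup>k+1\<^esup>\<close>,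
  and membership in \<open>DCz\<close> lets one solve these equations for the infinitesimal parts of \<open>U\<close> and \<open>W\<close>.\<close>

section \<open>Rank and factorization\<close>

lemma col_space_mult_subset:
  fixes B C :: "'a::field mat"
  assumes B: "B \<in> carrier_mat n k" and C: "C \<in> carrier_mat k l"
  shows "vec_space.col_space n (B * C) \<subseteq> vec_space.col_space n B"
proof -
  interpret vec_space "TYPE('a)" n .
  have "B * C *\<^sub>v x = B *\<^sub>v (C *\<^sub>v x)" if "x \<in> carrier_vec l" for x
    using B C that by simp
  moreover have "C *\<^sub>v x \<in> carrier_vec k" if "x \<in> carrier_vec l" for x
    using C that by simp
  ultimately show ?thesis
    using B C by (auto simp: col_space_eq[OF mult_carrier_mat[OF B C]] col_space_eq[OF B])
qed

text \<open>Every column of A lies in the image of B; chosen preimages of the columns of A form the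
  columns of U.\<close>

lemma col_space_subset_factor:
  fixes A B :: "'a::field mat"
  assumes A: "A \<in> carrier_mat n l" and B: "B \<in> carrier_mat n k"
    and sub: "vec_space.col_space n A \<subseteq> vec_space.col_space n B"
  shows "\<exists>U\<in>carrier_mat k l. A = B * U"
proof -
  interpret vec_space "TYPE('a)" n .
  have "\<exists>x\<in>carrier_vec k. B *\<^sub>v x = col A j" if "j < l" for j
  proof -
    have "col A j = A *\<^sub>v unit_vec l j"
      using A that by (intro eq_vecI) auto
    moreover have "A *\<^sub>v unit_vec l j \<in> col_space A"
      using A that by (auto simp: col_space_eq[OF A])
    ultimately show ?thesis
      using sub B by (auto simp: col_space_eq[OF B])
  qed
  then obtain f where f: "\<And>j. j < l \<Longrightarrow> f j \<in> carrier_vec k \<and> B *\<^sub>v f j = col A j"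
    by metis
  define U where "U = mat_of_cols k (map f [0..<l])"
  have U: "U \<in> carrier_mat k l"
    unfolding U_def using mat_of_cols_carrier(1)[of k "map f [0..<l]"] by simp
  moreover have "A = B * U"
  proof (rule eq_matI)
    fix i j assume "i < dim_row (B * U)" "j < dim_col (B * U)"
    then have ij: "i < n" "j < l" using B U by auto
    have "col U j = f j" using ij f unfolding U_def by (simp add: col_mat_of_cols)
    then have "(B * U) $$ (i, j) = (B *\<^sub>v f j) $ i"
      using ij B U by simp
    also have "\<dots> = A $$ (i, j)" using f ij A by simp
    finally show "A $$ (i, j) = (B * U) $$ (i, j)" by simp
  qed (use A B U in auto)
  ultimately show ?thesis by blast
qed

text \<open>A maximal independent set S of columns spans them all: a column outside its span could
  be added to S without losing independence.\<close>

lemma (in vec_space) col_space_indpt_basis: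
  assumes A: "A \<in> carrier_mat n k"
  obtains S where "S \<subseteq> carrier_vec n" "finite S" "lin_indpt S" "span S = col_space A" "card S = rank A"
proof -
  have cols: "set (cols A) \<subseteq> carrier_vec n" using cols_dim A by blast
  obtain S where S: "maximal S (\<lambda>T. T \<subseteq> set (cols A) \<and> lin_indpt T)"
    using maximal_exists_superset[of "set (cols A)" "\<lambda>T. T \<subseteq> set (cols A) \<and> lin_indpt T" "{}"]
      li_le_dim(1) by (auto simp: lin_dep_def)
  then have sub: "S \<subseteq> set (cols A)" and li: "lin_indpt S" by (auto simp: maximal_def)
  have "set (cols A) \<subseteq> span S"
  proof
    fix v assume v: "v \<in> set (cols A)"
    show "v \<in> span S"
    proof (rule ccontr)
      assume nv: "v \<notin> span S"
      then have "lin_indpt (insert v S)"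
        using lin_dep_iff_in_span[of S v] li v sub cols span_mem[of S v] by (metis Un_commute insert_is_Un subset_iff subset_trans)
      moreover have "v \<notin> S" using nv span_mem sub cols by auto
      ultimately show False using S v sub unfolding maximal_def by blast
    qed
  qed
  moreover have S_carrier: "S \<subseteq> carrier_vec n" using sub cols by blast
  ultimately have "span S = col_space A"
    unfolding col_space_def
    using span_is_monotone[OF sub] span_is_subset[OF _ span_is_submodule[OF S_carrier]] by blast
  moreover have "finite S" using sub finite_subset by blast
  ultimately show ?thesis
    using that[of S] S_carrier li rank_card_indpt[OF A S] by simp
qed

text \<open>A basis of the column space of B C is an independent set inside the column space of B,
  which bounds the rank. If the ranks agree, it is a basis there too, so both column spaces coincide
  and B factors through B C.\<close>

lemma rank_mult_le:
  fixes B C :: "'a::field mat"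
  assumes B: "B \<in> carrier_mat n k" and C: "C \<in> carrier_mat k l"
  shows "vec_space.rank n (B * C) \<le> vec_space.rank n B"
    and "vec_space.rank n B \<le> vec_space.rank n (B * C) \<Longrightarrow> \<exists>U\<in>carrier_mat l k. B = B * C * U"
proof -
  interpret vec_space "TYPE('a)" n .
  have BC: "B * C \<in> carrier_mat n l" using B C by simp
  obtain S where S: "S \<subseteq> carrier_vec n" "finite S" "lin_indpt S"
      "span S = col_space (B * C)" "card S = rank (B * C)"
    using col_space_indpt_basis[OF BC] .
  have cols: "set (cols B) \<subseteq> carrier_vec n" using cols_dim B by blast
  have sm: "submodule class_ring (col_space B) V"
    unfolding col_space_def using cols by (rule span_is_submodule)
  interpret W: vectorspace class_ring "vs (col_space B)"
    using sm subspace_is_vs by (simp add: subspace_def vectorspace_axioms)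
  have fin: "W.fin_dim"
    unfolding col_space_def using fin_dim_span_cols[OF B] .
  have SW: "S \<subseteq> col_space B"
    using S(1,4) span_mem col_space_mult_subset[OF B C] by blast
  have li: "W.lin_indpt S"
    using span_li_not_depend(2)[OF SW sm] S(3) by blast
  have dimW: "W.dim = rank B" by (simp add: rank_def col_space_def)
  show le: "rank (B * C) \<le> rank B"
    using W.li_le_dim(2)[OF fin _ li] SW S(5) dimW by (simp add: carrier_vs_is_self)
  assume "rank B \<le> rank (B * C)"
  then have "W.basis S"
    using W.dim_li_is_basis[OF fin S(2) _ li] SW S(5) dimW by simp
  then have "span S = col_space B"
    unfolding W.basis_def using span_li_not_depend(1)[OF SW sm] by simp
  then show "\<exists>U\<in>carrier_mat l k. B = B * C * U"
    using col_space_subset_factor[OF B BC] S(4) by simp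
qed

section \<open>Block matrices as endomorphisms of sequences\<close>

text \<open>All blocks are embedded in one ring of additive maps on sequences, whatever their dimensions, so that
  noncommutative identities can be checked in the type class \<^class>\<open>ring_1\<close>.\<close>

typedef (overloaded) 'a::comm_ring_1 seq_endo =
  "{f :: (nat \<Rightarrow> 'a) \<Rightarrow> nat \<Rightarrow> 'a. \<forall>u v. f (\<lambda>i. u i + v i) = (\<lambda>i. f u i + f v i)}"
  by (rule exI[of _ id]) simp

setup_lifting type_definition_seq_endo

instantiation seq_endo :: (comm_ring_1) ring_1
begin

lift_definition zero_seq_endo :: "'a seq_endo" is "\<lambda>u i. 0" by simp
lift_definition one_seq_endo :: "'a seq_endo" is "\<lambda>u. u" by simp
lift_definition plus_seq_endo :: "'a seq_endo \<Rightarrow> 'a seq_endo \<Rightarrow> 'a seq_endo"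
  is "\<lambda>f g u i. f u i + g u i" by (auto simp: algebra_simps)
lift_definition minus_seq_endo :: "'a seq_endo \<Rightarrow> 'a seq_endo \<Rightarrow> 'a seq_endo"
  is "\<lambda>f g u i. f u i - g u i" by (auto simp: algebra_simps)
lift_definition uminus_seq_endo :: "'a seq_endo \<Rightarrow> 'a seq_endo"
  is "\<lambda>f u i. - f u i" by auto
lift_definition times_seq_endo :: "'a seq_endo \<Rightarrow> 'a seq_endo \<Rightarrow> 'a seq_endo"
  is "\<lambda>f g u. f (g u)" by auto

instance
proof
  show "(0::'a seq_endo) \<noteq> 1"
    by transfer (metis zero_neq_one)
qed (transfer; auto simp: algebra_simps)+

end

text \<open>The matrix acts from the coordinates starting at \<open>q\<close> to those starting at \<open>p\<close>.\<close>

lift_definition blk :: "nat \<Rightarrow> nat \<Rightarrow> 'a::comm_ring_1 mat \<Rightarrow> 'a seq_endo"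
  is "\<lambda>p q A v i. if p \<le> i \<and> i < p + dim_row A
      then \<Sum>j<dim_col A. A $$ (i - p, j) * v (q + j) else 0"
  by (auto simp: algebra_simps sum.distrib)

lemma blk_add:
  "A \<in> carrier_mat r c \<Longrightarrow> B \<in> carrier_mat r c \<Longrightarrow> blk p q (A + B) = blk p q A + blk p q B"
  by transfer (auto simp: fun_eq_iff algebra_simps sum.distrib)

lemma blk_minus:
  "A \<in> carrier_mat r c \<Longrightarrow> B \<in> carrier_mat r c \<Longrightarrow> blk p q (A - B) = blk p q A - blk p q B"
  by transfer (auto simp: fun_eq_iff algebra_simps sum_subtractf)

lemma blk_zero [simp]: "blk p q (0\<^sub>m r c) = 0"
  by transfer (auto simp: fun_eq_iff)

lemma blk_mult:
  assumes "A \<in> carrier_mat r c" "B \<in> carrier_mat c l"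
  shows "blk p q A * blk q l' B = blk p l' (A * B)"
proof -
  have sum: "(\<Sum>j<c. A $$ (x, j) * (\<Sum>k<l. B $$ (j, k) * v (l' + k)))
      = (\<Sum>k<l. (A * B) $$ (x, k) * v (l' + k))" if "x < r" for x v
  proof -
    have "(\<Sum>j<c. A $$ (x, j) * (\<Sum>k<l. B $$ (j, k) * v (l' + k)))
        = (\<Sum>j<c. \<Sum>k<l. A $$ (x, j) * B $$ (j, k) * v (l' + k))"
      by (simp add: sum_distrib_left mult.assoc)
    also have "\<dots> = (\<Sum>k<l. \<Sum>j<c. A $$ (x, j) * B $$ (j, k) * v (l' + k))"
      by (rule sum.swap)
    also have "\<dots> = (\<Sum>k<l. (A * B) $$ (x, k) * v (l' + k))"
      using assms that by (simp add: scalar_prod_def sum_distrib_right atLeast0LessThan)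
    finally show ?thesis .
  qed
  have "Rep_seq_endo (blk p q A * blk q l' B) v i = Rep_seq_endo (blk p l' (A * B)) v i" for v i
    using assms sum[of "i - p" v] by (auto simp: times_seq_endo.rep_eq blk.rep_eq)
  then show ?thesis
    by (simp add: Rep_seq_endo_inject[symmetric] fun_eq_iff)
qed

lemma blk_mult_disjoint:
  assumes "A \<in> carrier_mat r c" "B \<in> carrier_mat r' c'" "q + c \<le> q' \<or> q' + r' \<le> q"
  shows "blk p q A * blk q' l' B = 0"
  using assms by transfer (auto simp: fun_eq_iff intro!: sum.neutral)

lemma blk_inject:
  assumes "A \<in> carrier_mat r c" "B \<in> carrier_mat r c" "blk p q A = blk p q B"
  shows "A = B"
proof (rule eq_matI)
  fix i j assume ij: "i < dim_row B" "j < dim_col B"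
  \<comment> \<open>The unit sequence at coordinate q + j: applying a block to it and reading
    coordinate p + i returns the (i, j) entry.\<close>
  define v :: "nat \<Rightarrow> 'a" where "v = (\<lambda>l. if l = q + j then 1 else 0)"
  have *: "Rep_seq_endo (blk p q C) v (p + i) = C $$ (i, j)"
    if "C \<in> carrier_mat r c" for C :: "'a mat"
  proof -
    have "(\<Sum>l<c. C $$ (i, l) * v (q + l)) = (\<Sum>l<c. if l = j then C $$ (i, l) else 0)"
      by (intro sum.cong) (auto simp: v_def)
    also have "\<dots> = C $$ (i, j)" using ij assms by (simp add: sum.delta)
    finally show ?thesis using that ij assms by (auto simp: blk.rep_eq)
  qed
  show "A $$ (i, j) = B $$ (i, j)" using *[OF assms(1)] *[OF assms(2)] assms(3) by simp
qed (use assms in auto)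

lemma blk_four_block_mat:
  assumes "A \<in> carrier_mat r c" "B \<in> carrier_mat r c'" "C \<in> carrier_mat r' c" "D \<in> carrier_mat r' c'"
  shows "blk p q (four_block_mat A B C D)
    = blk p q A + blk p (q + c) B + blk (p + r) q C + blk (p + r) (q + c) D"
proof -
  have split: "(\<Sum>j<c + c'. g j) = (\<Sum>j<c. g j) + (\<Sum>j<c'. g (c + j))" for g :: "nat \<Rightarrow> 'a"
    by (induction c') (auto simp: add.assoc)
  have "Rep_seq_endo (blk p q (four_block_mat A B C D)) v i
      = Rep_seq_endo (blk p q A + blk p (q + c) B + blk (p + r) q C + blk (p + r) (q + c) D) v i" for v i
  proof -
    have d: "dim_row A = r" "dim_row B = r" "dim_row C = r'" "dim_row D = r'"
      "dim_col A = c" "dim_col B = c'" "dim_col C = c" "dim_col D = c'"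
      using assms by auto
    consider "i < p" | k where "i = p + k" "k < r" | k where "i = p + r + k" "k < r'" | "p + r + r' \<le> i"
      using le_Suc_ex[of p i] le_Suc_ex[of "p + r" i] by (metis add.assoc nat_add_left_cancel_less not_le)
    then show ?thesis
      by cases (auto simp: plus_seq_endo.rep_eq blk.rep_eq split d add.assoc cong: sum.cong_simp)
  qed
  then show ?thesis
    by (simp add: Rep_seq_endo_inject[symmetric] fun_eq_iff)
qed

lemma blk_mat_sum:
  assumes "finite I" "\<And>i. i \<in> I \<Longrightarrow> F i \<in> carrier_mat nr nc"
  shows "blk p q (mat_sum nr nc F I) = (\<Sum>i\<in>I. blk p q (F i))"
  using assms
proof (induction I)
  case empty
  have "mat_sum nr nc F {} = 0\<^sub>m nr nc" by (auto simp: mat_sum_def)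
  then show ?case by simp
next
  case (insert x I)
  have "mat_sum nr nc F (insert x I) = F x + mat_sum nr nc F I"
    using insert by (intro eq_matI) (auto simp: mat_sum_def)
  then show ?case
    using insert by (simp add: blk_add[of _ nr nc] mat_sum_def)
qed

text \<open>The extra factor matters for k = 0, where the ring power is the identity on all
  sequences but the matrix power is only the unit of the corner.\<close>

lemma blk_pow:
  assumes "A \<in> carrier_mat n n"
  shows "blk p p (A ^\<^sub>m k) = blk p p (1\<^sub>m n) * blk p p A ^ k"
proof (induction k)
  case (Suc k)
  have "blk p p (A ^\<^sub>m Suc k) = blk p p (A ^\<^sub>m k) * blk p p A"
    using assms by (simp add: blk_mult[of _ n n _ n])
  then show ?case using Suc by (simp add: mult.assoc power_commutes)
qed (use assms in simp)

section \<open>Drazin inverses in a corner ring\<close>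

text \<open>Here \<open>e\<close> is the unit of the corner ring containing \<open>a\<close>; the product \<open>e * a ^ k\<close> is the power
  in the corner ring even for \<open>k = 0\<close>.\<close>

definition drazin_wrt :: "'a::ring_1 \<Rightarrow> nat \<Rightarrow> 'a \<Rightarrow> 'a \<Rightarrow> bool" where
  "drazin_wrt e k a x \<longleftrightarrow> e * x = x \<and> x * e = x \<and>
     e * a ^ k * x * a = e * a ^ k \<and> x * a * x = x \<and> a * x = x * a"

lemma commuting_power:
  fixes a b :: "'a::monoid_mult"
  shows "a * b = b * a \<Longrightarrow> a ^ n * b = b * a ^ n"
  by (induction n) (auto simp: mult.assoc, metis mult.assoc)

lemma commuting_power_mult:
  fixes a b :: "'a::monoid_mult"
  assumes "a * b = b * a"
  shows "(a * b) ^ n = a ^ n * b ^ n"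
proof (induction n)
  case (Suc n)
  have "(a * b) ^ Suc n = a * (b * a ^ n) * b ^ n"
    by (simp add: Suc mult.assoc)
  also have "\<dots> = a ^ Suc n * b ^ Suc n"
    using commuting_power[OF assms, of n, symmetric] by (simp only: power_Suc mult.assoc)
  finally show ?case .
qed simp

lemma idem_power:
  fixes p :: "'a::monoid_mult"
  shows "p * p = p \<Longrightarrow> n > 0 \<Longrightarrow> p ^ n = p"
  by (induction n) (auto, metis mult_1_right power_0 neq0_conv)

text \<open>Since x a commutes with a, the surplus factor a^j can be moved past it.\<close>

lemma drazin_wrt_mono:
  assumes "drazin_wrt e k a x" "e * a = a" "a * e = a" "k \<le> l"
  shows "drazin_wrt e l a x"
proof -
  obtain j where j: "l = k + j" using assms(4) le_Suc_ex by blast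
  have x: "e * a ^ k * x * a = e * a ^ k" "a * x = x * a" "e * x = x" "x * e = x"
    using assms by (auto simp: drazin_wrt_def)
  have ax: "a ^ j * (x * a) = (x * a) * a ^ j"
    by (rule commuting_power) (metis mult.assoc x(2))
  have "e * a ^ l * x * a = e * a ^ k * (a ^ j * (x * a))"
    by (simp add: j power_add mult.assoc)
  also have "\<dots> = e * a ^ k * x * a * a ^ j"
    by (simp only: ax mult.assoc)
  also have "\<dots> = e * a ^ l" using x by (simp add: j power_add mult.assoc)
  finally show ?thesis using assms by (simp add: drazin_wrt_def)
qed

lemma drazin_wrt_corner:
  assumes "drazin_wrt e k a x" "a * e = a"
  shows "e * (x * a) = x * a" "(x * a) * e = x * a"
  using assms by (simp_all add: drazin_wrt_def mult.assoc) (simp add: mult.assoc[symmetric])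

text \<open>The idempotent x a is a two-sided unit for a high power of a and is itself a product of
  powers of x and a. These identities carry properties of a over to x a.\<close>

lemma drazin_wrt_projection:
  assumes x: "drazin_wrt e k a x" and ea: "e * a = a" "a * e = a"
  obtains m where "a ^ m * (x * a) = a ^ m" "(x * a) * a ^ m = a ^ m"
    "x ^ m * a ^ m = x * a" "a ^ m * x ^ m = x * a"
proof -
  \<comment> \<open>A positive exponent makes \<open>e * a ^ m\<close> equal to a^m and the m-th
    power of the idempotent x a equal to x a.\<close>
  define m where "m = Suc k"
  have "e * a ^ m = a ^ m" using ea by (simp add: m_def mult.assoc[symmetric])
  moreover have "drazin_wrt e m a x" using drazin_wrt_mono[OF x ea] by (simp add: m_def)
  ultimately have x1: "a ^ m * (x * a) = a ^ m" "x * a * x = x" "a * x = x * a"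
    by (auto simp: drazin_wrt_def mult.assoc)
  have p: "(x * a) ^ m = x * a"
    using x1(2) by (auto intro!: idem_power simp: mult.assoc[symmetric]) (simp_all add: m_def)
  show ?thesis
  proof
    show "a ^ m * (x * a) = a ^ m" by (rule x1)
    then show "(x * a) * a ^ m = a ^ m"
      using commuting_power[of a "x * a" m] x1(3) by (metis mult.assoc)
    show "x ^ m * a ^ m = x * a" using p commuting_power_mult[of x a m] x1 by simp
    show "a ^ m * x ^ m = x * a" using p commuting_power_mult[of a x m] x1 by simp
  qed
qed

text \<open>With q = x a, commutation of b with a^m gives q b = q b q and b q = q b q, hence q b = b
  q. The claim then follows from x = q x and a x = x a.\<close>

lemma drazin_wrt_commute:
  assumes x: "drazin_wrt e k a x" and ea: "e * a = a" "a * e = a" and b: "a * b = b * a"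
  shows "x * b = b * x"
proof -
  obtain m where m: "a ^ m * (x * a) = a ^ m" "(x * a) * a ^ m = a ^ m"
    "x ^ m * a ^ m = x * a" "a ^ m * x ^ m = x * a"
    using drazin_wrt_projection[OF x ea] .
  have ab: "a ^ m * b = b * a ^ m" using b by (rule commuting_power)
  have "(x * a) * b = x ^ m * b * a ^ m" using m(3) ab by (metis mult.assoc)
  also have "\<dots> = x ^ m * b * a ^ m * (x * a)" using m(1) by (simp add: mult.assoc)
  also have "\<dots> = (x * a) * b * (x * a)" using m(3) ab by (metis mult.assoc)
  finally have 1: "(x * a) * b = (x * a) * b * (x * a)" .
  have "b * (x * a) = a ^ m * b * x ^ m" using m(4) ab by (metis mult.assoc)
  also have "\<dots> = (x * a) * (a ^ m * b * x ^ m)" using m(2) by (simp add: mult.assoc[symmetric])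
  also have "\<dots> = (x * a) * b * (x * a)" using m(4) ab by (metis mult.assoc)
  finally have 2: "(x * a) * b = b * (x * a)" using 1 by simp
  have x1: "x * a * x = x" "a * x = x * a" using x by (auto simp: drazin_wrt_def)
  have "x * b = x * ((x * a) * b)" using x1 by (metis mult.assoc)
  also have "\<dots> = x * b * (a * x)" using 2 x1 by (simp add: mult.assoc)
  also have "\<dots> = (x * a) * b * x" using b by (metis mult.assoc)
  also have "\<dots> = b * x" using 2 x1 by (simp add: mult.assoc)
  finally show ?thesis .
qed

text \<open>Both x a and y a equal the product (x a)(y a), so the two idempotents agree; then x = x
  (y a) = (x a) y = y. The two indices may differ because both are first raised to a common
  m.\<close>

lemma drazin_wrt_unique:
  assumes x: "drazin_wrt e k a x" and y: "drazin_wrt e l a y" and ea: "e * a = a" "a * e = a"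
  shows "x = y"
proof -
  define m where "m = Suc (k + l)"
  have x': "drazin_wrt e m a x" and y': "drazin_wrt e m a y"
    using drazin_wrt_mono[OF x ea, of m] drazin_wrt_mono[OF y ea, of m] by (auto simp: m_def)
  have em: "e * a ^ m = a ^ m" using ea by (simp add: m_def mult.assoc[symmetric])
  have x1: "a ^ m * (x * a) = a ^ m" "x * a * x = x" "a * x = x * a"
    and y1: "a ^ m * (y * a) = a ^ m" "y * a * y = y" "a * y = y * a"
    using x' y' em by (auto simp: drazin_wrt_def mult.assoc)
  have p: "(x * a) ^ m = x * a" and q: "(y * a) ^ m = y * a"
    using x1(2) y1(2) by (auto intro!: idem_power simp: mult.assoc[symmetric]) (simp_all add: m_def)
  have "x * a = x ^ m * a ^ m" using p commuting_power_mult[of x a m] x1 by simp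
  also have "\<dots> = (x * a) * (y * a)"
    using p commuting_power_mult[of x a m] x1 y1 by (metis mult.assoc)
  finally have 1: "x * a = (x * a) * (y * a)" .
  have "y * a = a ^ m * y ^ m" using q commuting_power_mult[of a y m] y1 by simp
  also have "\<dots> = (a ^ m * (x * a)) * y ^ m" using x1 by simp
  also have "\<dots> = (x * a) * (a ^ m * y ^ m)"
    using commuting_power[of a "x * a" m] x1 by (simp add: mult.assoc) (metis mult.assoc)
  also have "\<dots> = (x * a) * (y * a)" using q commuting_power_mult[of a y m] y1 by simp
  finally have 2: "x * a = y * a" using 1 by simp
  have "x = x * (y * a)" using x1 2 by (metis mult.assoc)
  also have "\<dots> = (x * a) * y" using y1 by (simp add: mult.assoc)
  also have "\<dots> = y" using 2 y1 by simp
  finally show ?thesis .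
qed

text \<open>Iterating the equation for u writes e a^k as e a^(k+l) u^l. From the left, x a fixes e
  a^(k+l), hence also e a^k, and it commutes with that power.\<close>

lemma drazin_wrt_index:
  assumes x: "drazin_wrt e l a x" and ea: "e * a = a" "a * e = a"
    and u: "e * a ^ k = e * a ^ Suc k * u"
  shows "drazin_wrt e k a x"
proof -
  have step: "e * a ^ k = e * a ^ (k + j) * u ^ j" for j
  proof (induction j)
    case (Suc j)
    have ae: "a ^ j * e = e * a ^ j" by (rule commuting_power) (simp add: ea)
    have "e * a ^ (k + j) = a ^ j * (e * a ^ k)"
      using ae by (simp add: power_add[symmetric] mult.assoc[symmetric] add.commute[of k])
        (simp add: power_add mult.assoc[symmetric])
    also have "\<dots> = (a ^ j * e) * a ^ Suc k * u"
      using u by (simp only: mult.assoc)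
    also have "\<dots> = e * a ^ (k + Suc j) * u"
      unfolding ae by (simp only: mult.assoc power_add[symmetric] add.commute[of k] add_Suc add_Suc_right)
    finally show ?case using Suc by (simp add: mult.assoc)
  qed simp
  have comm: "(x * a) * (e * a ^ (k + l)) = e * a ^ (k + l) * (x * a)"
  proof -
    have "a ^ (k + l) * (x * a) = (x * a) * a ^ (k + l)"
      using x by (intro commuting_power) (metis drazin_wrt_def mult.assoc)
    moreover have "e * (x * a) = x * a" "(x * a) * e = x * a"
      using drazin_wrt_corner[OF x ea(2)] by auto
    ultimately show ?thesis by (metis mult.assoc)
  qed
  have fix': "(x * a) * (e * a ^ (k + l)) = e * a ^ (k + l)"
    using drazin_wrt_mono[OF x ea, of "k + l"] comm by (simp add: drazin_wrt_def mult.assoc)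
  have *: "(x * a) * (e * a ^ k) = e * a ^ k"
    by (subst (1 2) step[of l]) (use fix' in \<open>simp add: mult.assoc[symmetric]\<close>)
  have "a ^ k * (x * a) = (x * a) * a ^ k"
      using x by (intro commuting_power) (metis drazin_wrt_def mult.assoc)
  moreover have "e * (x * a) = x * a" "(x * a) * e = x * a"
    using drazin_wrt_corner[OF x ea(2)] by auto
  ultimately have "e * a ^ k * (x * a) = (x * a) * (e * a ^ k)" by (metis mult.assoc)
  with * have "e * a ^ k * x * a = e * a ^ k" by (simp add: mult.assoc)
  with x show ?thesis by (simp add: drazin_wrt_def)
qed

text \<open>Iteration gives \<open>G k\<close> = \<open>G (k + j)\<close> u^j = w^j
  \<open>G (k + j)\<close>. So the candidate has one form with u on the right and one with w on the
  left, and a x and x a both equal w^k \<open>G (k + k)\<close> u^k.\<close>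

lemma drazin_wrt_exists:
  assumes e: "e * e = e" "e * a = a" "a * e = a"
    and u: "e * u = u" "u * e = u" "e * a ^ k = e * a ^ Suc k * u"
    and w: "e * w = w" "w * e = w" "e * a ^ k = w * a ^ Suc k"
  shows "drazin_wrt e k a (e * a ^ k * u ^ Suc k)"
proof -
  define G where "G j = e * a ^ j" for j
  have ae: "a ^ j * e = e * a ^ j" for j by (rule commuting_power) (simp add: e)
  have GG: "G i * G j = G (i + j)" for i j
    unfolding G_def by (metis ae e(1) mult.assoc power_add)
  have eG: "e * G j = G j" "G j * e = G j" for j
    using e ae by (simp_all add: G_def mult.assoc[symmetric]) (metis ae e(1) mult.assoc)
  have aG: "a * G j = G (Suc j)" "G j * a = G (Suc j)" for j
    using e ae by (simp_all add: G_def mult.assoc[symmetric] power_commutes)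
      (metis ae mult.assoc power_commutes)
  have u1: "G k = G (Suc k) * u" and w1: "G k = w * G (Suc k)"
    using u w e by (simp_all add: G_def mult.assoc[symmetric])
  have uG: "G (k + j) = G (Suc (k + j)) * u" for j
    by (metis GG add.commute add_Suc_right mult.assoc u1)
  have wG: "G (k + j) = w * G (Suc (k + j))" for j
    by (metis GG add_Suc mult.assoc w1)
  have U: "G (k + i) = G (k + i + j) * u ^ j" for i j
  proof (induction j)
    case (Suc j)
    show ?case using uG[of "i + j"] Suc by (simp add: mult.assoc[symmetric] add.assoc power_commutes)
  qed simp
  have W: "G (k + i) = w ^ j * G (k + i + j)" for i j
  proof (induction j)
    case (Suc j)
    show ?case using wG[of "i + j"] Suc
      by (simp add: power_Suc2 mult.assoc add.assoc del: power_Suc)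
  qed simp
  define x where "x = G k * u ^ Suc k"
  have x2: "x = w ^ Suc k * G k"
  proof -
    have "x = w ^ Suc k * G (k + Suc k) * u ^ Suc k"
      using W[of 0 "Suc k"] by (simp add: x_def)
    also have "\<dots> = w ^ Suc k * G k" using U[of 0 "Suc k"] by (simp add: mult.assoc)
    finally show ?thesis .
  qed
  have ax: "a * x = G k * u ^ k"
  proof -
    have "a * x = G (k + 0 + 1) * u ^ 1 * u ^ k" by (simp add: x_def mult.assoc[symmetric] aG)
    then show ?thesis using U[of 0 1] by simp
  qed
  have xa: "x * a = w ^ k * G k"
  proof -
    have "x * a = w ^ k * (w ^ 1 * G (k + 0 + 1))"
      by (simp add: x2 power_Suc2 mult.assoc aG del: power_Suc)
    then show ?thesis using W[of 0 1] by simp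
  qed
  have comm: "a * x = x * a"
    using W[of 0 k] U[of 0 k] unfolding ax xa by (metis add.right_neutral mult.assoc)
  have Gx: "G k * (a * x) = G k"
    unfolding ax mult.assoc[symmetric] GG using U[of 0 k] by simp
  have "x * a * x = x"
    using Gx by (simp add: x2 mult.assoc)
  moreover have "e * x = x" "x * e = x"
    using eG by (simp add: x_def mult.assoc[symmetric]) (use eG in \<open>simp add: x2 mult.assoc\<close>)
  moreover have "e * a ^ k * x * a = e * a ^ k"
    using Gx comm by (simp add: G_def mult.assoc)
  ultimately show ?thesis using comm unfolding drazin_wrt_def x_def G_def by blast
qed

section \<open>Anti-triangular block elements\<close>

text \<open>The orthogonal idempotents e and f are the units of the two diagonal corners; a, b, c
  are the blocks of the matrix (a b; c 0), whose unit is e + f.\<close>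

locale anti_triangular =
  fixes e f a b c d t :: "'a::ring_1" and k s :: nat
  assumes ee: "e * e = e" and ff: "f * f = f" and ef: "e * f = 0" and fe: "f * e = 0"
    and ea: "e * a = a" and ae: "a * e = a" and eb: "e * b = b" and bf: "b * f = b"
    and fc: "f * c = c" and ce: "c * e = c"
    and d: "drazin_wrt e k a d" and t: "drazin_wrt e s (b * c) t"
    and commute: "a * (e - a * d) * (b * c) = b * c * a * (e - a * d)"
    and core_zero: "b * c * a * (a * d) = 0"
begin

definition \<phi> where "\<phi> = b * c"
definition \<rho> where "\<rho> = e - a * d"
definition \<psi> where "\<psi> = e - \<phi> * t"
definition n where "n = a * \<rho>"
definition S where "S j = (\<Sum>i<s. d ^ (2 * i + j) * \<psi> * \<phi> ^ i)"
definition m where "m = a + b + c"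
definition y where "y = S 2 + \<rho> * t"
definition z where "z = S 3 - n * t ^ 2 - d * t"
definition x where "x = S 1 + y * b + c * y + c * z * b"


text \<open>This rule and the next two let an equation for a short product also rewrite inside a
  longer word associated to the right.\<close>

lemma mult_assoc_zero: "u * v = 0 \<Longrightarrow> u * (v * w) = 0" for u v w :: 'a
  by (simp add: mult.assoc[symmetric])

lemma mult_assoc2: "u * v = r \<Longrightarrow> u * (v * w) = r * w" for u v w r :: 'a
  by (simp add: mult.assoc[symmetric])

lemma mult_assoc3: "u * (v * v') = r \<Longrightarrow> u * (v * (v' * w)) = r * w" for u v v' w r :: 'a
  by (simp add: mult.assoc[symmetric])

lemmas dist = distrib_left distrib_right left_diff_distrib right_diff_distrib

section \<open>Relations between a, \<phi> and their Drazin inverses\<close>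

lemma d': "e * d = d" "d * e = d" "a * d = d * a" "d * (d * a) = d" "e * a ^ k * d * a = e * a ^ k"
  using d by (auto simp: drazin_wrt_def) (metis mult.assoc)

lemma t': "e * t = t" "t * e = t" "\<phi> * t = t * \<phi>" "t * (t * \<phi>) = t" "e * \<phi> ^ s * t * \<phi> = e * \<phi> ^ s"
  using t by (auto simp: drazin_wrt_def \<phi>_def[symmetric]) (metis mult.assoc)

lemma e_phi: "e * \<phi> = \<phi>" "\<phi> * e = \<phi>"
  using eb ce by (simp_all add: \<phi>_def mult.assoc) (simp add: mult.assoc[symmetric])

lemma e_rho: "e * \<rho> = \<rho>" "\<rho> * e = \<rho>"
  using ee ea ae d' by (simp_all add: \<rho>_def dist mult.assoc mult_assoc2[OF d'(1)])

text \<open>The identity d = a^2 d^3 exposes the factor \<phi> a (a d), which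
  \<open>core_zero\<close> kills.\<close>

lemma phi_d: "\<phi> * d = 0"
proof -
  have "a * (a * (d * (d * d))) = d"
    by (simp add: mult.assoc d' d'(3)[THEN mult_assoc2] d'(4)[THEN mult_assoc3])
  then have "\<phi> * d = b * c * a * (a * d) * d * d"
    by (simp add: \<phi>_def mult.assoc)
  then show ?thesis by (simp add: core_zero)
qed

lemma t_d: "t * d = 0"
proof -
  have "t * d = t * (t * \<phi>) * d" using t' by simp
  then show ?thesis by (simp add: mult.assoc phi_d)
qed

lemmas da_simps = d'(1-4) d'(3)[THEN mult_assoc2] d'(4)[THEN mult_assoc3] d'(1)[THEN mult_assoc2] d'(2)[THEN mult_assoc2]
  ea ae ea[THEN mult_assoc2] ae[THEN mult_assoc2] ee ee[THEN mult_assoc2]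
  t'(1-4) t'(3)[THEN mult_assoc2] t'(4)[THEN mult_assoc3] t'(1)[THEN mult_assoc2] t'(2)[THEN mult_assoc2]
  e_phi e_phi[THEN mult_assoc2] phi_d t_d phi_d[THEN mult_assoc_zero] t_d[THEN mult_assoc_zero]

lemma n_eq: "n = a - d * (a * a)" and rho_eq: "\<rho> = e - d * a"
  by (simp_all add: n_def \<rho>_def dist mult.assoc da_simps)

lemma phi_a: "\<phi> * a = a * \<phi> - d * (a * (a * \<phi>))"
proof -
  have "n * \<phi> = \<phi> * a * \<rho>"
    using commute by (simp add: n_def \<rho>_def \<phi>_def mult.assoc)
  also have "\<dots> = \<phi> * a"
    by (simp add: rho_eq dist mult.assoc da_simps)
  finally show ?thesis by (simp add: n_eq dist mult.assoc)
qed


text \<open>As n commutes with \<phi>, it commutes with the Drazin inverse t; moreover t n = t a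
  because t d = 0.\<close>

lemma t_a: "t * a = a * t - d * (a * (a * t))"
proof -
  have "n * \<phi> = \<phi> * n"
    by (simp add: n_eq dist mult.assoc phi_a da_simps phi_a[THEN mult_assoc2])
  then have "t * n = n * t"
    using drazin_wrt_commute[OF t[folded \<phi>_def] e_phi, of n] by simp
  then show ?thesis
    by (simp add: n_eq dist mult.assoc da_simps)
qed

lemma eq_zero_e_f: "u * v = 0" if "u * e = u" "f * v = v" for u v
proof -
  have "u * v = u * e * (f * v)" using that by simp
  also have "\<dots> = u * (e * f) * v" by (simp only: mult.assoc)
  finally show ?thesis by (simp add: ef)
qed

lemma eq_zero_f_e: "u * v = 0" if "u * f = u" "e * v = v" for u v
proof -
  have "u * v = u * f * (e * v)" using that by simp
  also have "\<dots> = u * (f * e) * v" by (simp only: mult.assoc)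
  finally show ?thesis by (simp add: fe)
qed

lemma psi_eq: "\<psi> = e - t * \<phi>"
  by (simp add: \<psi>_def t')

lemma e_psi: "e * \<psi> = \<psi>" "\<psi> * e = \<psi>"
  by (simp_all add: psi_eq dist mult.assoc da_simps)

text \<open>This is the index equation of t; it is what makes the sums S j close up after s
  terms.\<close>

lemma psi_phi_power_s: "\<psi> * \<phi> ^ s = 0"
proof -
  have "e * \<phi> ^ s = \<phi> ^ s * e" using e_phi commuting_power[of \<phi> e s] by simp
  moreover have "\<phi> ^ s * (t * \<phi>) = (t * \<phi>) * \<phi> ^ s"
    by (rule commuting_power) (metis mult.assoc t'(3))
  ultimately show ?thesis
    using t'(5) e_phi t'(1,2) by (simp add: psi_eq dist mult.assoc)
qed

lemma psi_phi: "\<psi> * \<phi> = \<phi> * \<psi>"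
  by (simp add: psi_eq dist mult.assoc da_simps)

lemma psi_phi_power: "\<psi> * \<phi> ^ i = \<phi> ^ i * \<psi>"
  using commuting_power[of \<phi> \<psi> i] psi_phi by simp

section \<open>Calculus of the sums S j\<close>

lemma d_power_left: "j > 0 \<Longrightarrow> u * d = 0 \<Longrightarrow> u * (d ^ j * v) = 0"
  by (cases j) (auto simp: mult.assoc[symmetric])

lemma phi_S: "j > 0 \<Longrightarrow> \<phi> * S j = 0" and t_S: "j > 0 \<Longrightarrow> t * S j = 0"
  by (auto simp: S_def sum_distrib_left mult.assoc d_power_left phi_d t_d)

lemma d_S: "d * S j = S (Suc j)"
  by (simp add: S_def sum_distrib_left mult.assoc)

lemma e_S: "j > 0 \<Longrightarrow> e * S j = S j" and S_e: "S j * e = S j"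
proof -
  show "e * S j = S j" if "j > 0"
    using that d'(1) by (cases j) (auto simp flip: d_S simp: mult.assoc[symmetric])
  show "S j * e = S j"
    unfolding S_def sum_distrib_right
    by (intro sum.cong refl) (simp add: mult.assoc psi_phi_power e_psi)
qed

lemma a_S: "j > 1 \<Longrightarrow> a * S j = S (j - 1)"
proof -
  assume "j > 1"
  \<comment> \<open>Two factors d are needed: one absorbs a, the other absorbs the resulting
    idempotent d a.\<close>
  then obtain i where i: "j = Suc (Suc i)" by (metis One_nat_def less_imp_Suc_add plus_1_eq_Suc add_Suc)
  show ?thesis unfolding i by (simp flip: d_S add: da_simps mult.assoc d'(3)[THEN mult_assoc2])
qed

lemma psi_t: "\<psi> * t = 0"
  by (simp add: psi_eq dist mult.assoc da_simps)

lemma S_t: "S j * t = 0"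
proof -
  have "\<phi> ^ i * t = t * \<phi> ^ i" for i by (rule commuting_power) (simp add: t')
  then show ?thesis
    by (simp add: S_def sum_distrib_right mult.assoc psi_t[THEN mult_assoc_zero])
qed

text \<open>Right multiplication by \<phi> sends the i-th term to the (i+1)-st term of S j. The new
  last term contains \<psi> \<phi>^s = 0, and the missing first term is d^j \<psi>.\<close>

lemma S_phi: "S (j + 2) * \<phi> = S j - d ^ j * \<psi>"
proof -
  have "S (j + 2) * \<phi> = (\<Sum>i<s. d ^ (2 * Suc i + j) * \<psi> * \<phi> ^ Suc i)"
    by (simp add: S_def sum_distrib_right mult.assoc power_commutes)
  also have "\<dots> = (\<Sum>i<Suc s. d ^ (2 * i + j) * \<psi> * \<phi> ^ i) - d ^ j * \<psi>"
    by (subst sum.lessThan_Suc_shift) simp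
  also have "\<dots> = S j - d ^ j * \<psi>"
    by (simp add: S_def mult.assoc psi_phi_power_s)
  finally show ?thesis .
qed

text \<open>Together with distributivity these rules bring words in \<open>a, d, \<phi>, t\<close> to a normal form in which
  the letters \<open>d\<close> precede \<open>a\<close>, and both precede \<open>t\<close> and \<open>\<phi>\<close>.\<close>

lemmas nf_simps = da_simps phi_a t_a phi_a[THEN mult_assoc2] t_a[THEN mult_assoc2]

lemma d_psi_a: "d * (\<psi> * a) = d * a"
  by (simp add: psi_eq dist mult.assoc nf_simps)

lemma n_commute: "n * \<phi> = \<phi> * n" "n * t = t * n" "n * \<psi> = \<psi> * n" "\<phi> * a = n * \<phi>" "d * n = 0"
  by (simp_all add: n_eq psi_eq dist mult.assoc nf_simps)

text \<open>Writing \<phi> a as n \<phi> and moving n to the far left brings it next to d, where d n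
  = 0.\<close>

lemma d_psi_phi_a: "d * (\<psi> * (\<phi> ^ Suc i * a)) = 0"
proof -
  have "\<psi> * (\<phi> ^ Suc i * a) = \<psi> * (\<phi> ^ i * (n * \<phi>))"
    by (simp add: power_Suc2 mult.assoc n_commute(4) del: power_Suc)
  also have "\<dots> = n * (\<psi> * \<phi> ^ Suc i)"
    using commuting_power[of \<phi> n i] n_commute by (metis mult.assoc power_Suc2)
  finally show ?thesis by (simp only: n_commute(5)[THEN mult_assoc_zero])
qed

lemma S_a: "j > 0 \<Longrightarrow> S j * a = d ^ j * a"
proof -
  assume "j > 0"
  then obtain i where i: "j = Suc i" by (cases j) auto
  have l: "d ^ (2 * l + j) * \<psi> * \<phi> ^ l * a = (if l = 0 then d ^ j * a else 0)" for l
  proof (cases l)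
    case 0
    then show ?thesis by (simp add: i power_Suc2 mult.assoc d_psi_a del: power_Suc)
  next
    case (Suc l')
    have "d ^ (2 * l + j) * \<psi> * \<phi> ^ l * a = d ^ (2 * l + i) * (d * (\<psi> * (\<phi> ^ Suc l' * a)))"
      by (simp add: i Suc power_Suc2 mult.assoc del: power_Suc)
    then show ?thesis using Suc by (simp only: d_psi_phi_a) simp
  qed
  show "S j * a = d ^ j * a"
  \<comment> \<open>For s = 0 the sum is empty and has no term at 0 to survive; but then \<psi> = 0,
    so d^j a vanishes as well.\<close>
  proof (cases "s = 0")
    case True
    then have "\<psi> = 0" using psi_phi_power_s by simp
    then have "d ^ j * a = 0" using d_psi_a by (simp add: i power_Suc2 mult.assoc del: power_Suc)
    moreover have "S j = 0" using True unfolding S_def by simp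
    ultimately show ?thesis by simp
  next
    case False
    then show ?thesis by (simp add: S_def sum_distrib_right l)
  qed
qed

lemma S_a_numeral: "S 1 * a = d * a" "S 2 * a = d" "S 3 * a = d * d"
  by (simp_all add: S_a power2_eq_square power3_eq_cube mult.assoc da_simps)

lemma S_d_numeral: "S 1 * d = d * d" "S 2 * d = d * (d * d)" "S 3 * d = d * (d * (d * d))"
proof -
  \<comment> \<open>The identity d = a d^2 reduces right multiplication by d to the known right
    multiplication by a.\<close>
  have *: "u * d = u * a * (d * d)" for u by (simp add: da_simps mult.assoc)
  show "S 1 * d = d * d" "S 2 * d = d * (d * d)" "S 3 * d = d * (d * (d * d))"
    unfolding *[of "S _"] S_a_numeral by (simp_all add: mult.assoc da_simps)
qed

lemma psi_S: "j > 0 \<Longrightarrow> \<psi> * S j = S j"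
  by (simp add: psi_eq dist mult.assoc phi_S e_S)

lemma d_power_S: "d ^ j * S i = S (i + j)"
  by (induction j) (auto simp: mult.assoc d_S)

text \<open>Since \<phi> annihilates S i from the left, only the term with \<phi>^0 contributes, and
  there \<psi> acts as the identity.\<close>

lemma S_S: "i > 0 \<Longrightarrow> j > 0 \<Longrightarrow> S j * S i = S (i + j)"
proof -
  assume i: "i > 0" and j: "j > 0"
  have l: "d ^ (2 * l + j) * \<psi> * \<phi> ^ l * S i = (if l = 0 then S (i + j) else 0)" for l
    using i by (cases l) (simp_all add: power_Suc2 mult.assoc phi_S psi_S d_power_S del: power_Suc)
  show ?thesis
  proof (cases "s = 0")
    case True
    then have "S l = 0" for l unfolding S_def by simp
    then show ?thesis by simp
  next
    case False
    then show ?thesis by (subst S_def) (simp add: sum_distrib_right l)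
  qed
qed

lemma S3_phi: "S 3 * \<phi> = S 1 - d * \<psi>" and S4_phi: "S 4 * \<phi> = S 2 - d * (d * \<psi>)"
  using S_phi[of 1] S_phi[of 2] by (simp_all del: One_nat_def add: power2_eq_square mult.assoc)

lemma a_S_numeral: "a * S 2 = S 1" "a * S 3 = S 2" "a * S 1 = d * (a * \<psi>) + S 2 * \<phi>"
proof -
  show "a * S 2 = S 1" "a * S 3 = S 2" by (simp_all add: a_S)
  have "S 1 = S 3 * \<phi> + d * \<psi>" by (simp add: S3_phi)
  then show "a * S 1 = d * (a * \<psi>) + S 2 * \<phi>"
    by (simp del: One_nat_def add: dist mult.assoc[symmetric] a_S d'(3))
qed

lemma d_S_numeral: "d * S 1 = S 2" "d * S 2 = S 3"
  by (simp_all add: d_S numeral_eq_Suc)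

lemma S_S_numeral: "S 1 * S 1 = S 2" "S 1 * S 2 = S 3" "S 2 * S 1 = S 3" "S 2 * S 2 = S 4"
  by (simp_all add: S_S numeral_eq_Suc)

section \<open>Block products and the relations between m and x\<close>

lemma b_c: "b * c = \<phi>"
  by (simp add: \<phi>_def)

lemma e_c: "w * e = w \<Longrightarrow> w * c = 0"
  using eq_zero_e_f fc by blast

lemma b_e: "e * w = w \<Longrightarrow> b * w = 0"
  using eq_zero_f_e bf by blast

lemma c_c: "c * c = 0"
  using e_c[OF ce] .

lemma b_b: "b * b = 0"
  using b_e[OF eb] .

lemmas S_rules = phi_S t_S S_t S3_phi S4_phi S_a_numeral S_d_numeral a_S_numeral d_S_numeral S_S_numeral e_S S_e
lemmas S_simps = S_rules phi_S[THEN mult_assoc_zero] t_S[THEN mult_assoc_zero] S_t[THEN mult_assoc_zero]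
  S3_phi[THEN mult_assoc2] S4_phi[THEN mult_assoc2] S_a_numeral[THEN mult_assoc2] S_d_numeral[THEN mult_assoc2] a_S_numeral[THEN mult_assoc2]
  d_S_numeral[THEN mult_assoc2] S_S_numeral[THEN mult_assoc2] e_S[THEN mult_assoc2] S_e[THEN mult_assoc2]

lemma block_rules: "a * c = 0" "d * c = 0" "t * c = 0" "\<phi> * c = 0" "S j * c = 0"
   "b * a = 0" "b * d = 0" "b * t = 0" "b * \<phi> = 0" "j > 0 \<Longrightarrow> b * S j = 0"
  by (intro e_c b_e; simp add: ae ea d' t' e_phi e_S S_e)+

lemmas block_simps = block_rules block_rules[THEN mult_assoc_zero] b_b b_b[THEN mult_assoc_zero]
  c_c c_c[THEN mult_assoc_zero] b_c b_c[THEN mult_assoc2] eb eb[THEN mult_assoc2] ce ce[THEN mult_assoc2]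

text \<open>The right side is a common normal form: \<open>x_m\<close> reaches the same expression,
  which shows that m and x commute.\<close>

lemma m_x: "m * x = a * S 1 + \<phi> * t + S 1 * b + c * S 1 + c * (y * b)"
  by (simp del: One_nat_def add: m_def x_def y_def z_def rho_eq n_eq psi_eq power2_eq_square dist mult.assoc nf_simps S_simps block_simps)

lemma x_m: "x * m = a * S 1 + \<phi> * t + S 1 * b + c * S 1 + c * (y * b)"
  by (simp del: One_nat_def add: m_def x_def y_def z_def rho_eq n_eq psi_eq power2_eq_square dist mult.assoc nf_simps S_simps block_simps)

lemma x_m_x: "x * m * x = x"
  unfolding mult.assoc m_x
  by (simp del: One_nat_def add: x_def y_def z_def rho_eq n_eq psi_eq power2_eq_square dist mult.assoc nf_simps S_simps block_simps)


section \<open>A power of m annihilates the complementary idempotent K\<close>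

definition K where "K = e + f - m * x"


definition v where "v j = e * m ^ j * K"

text \<open>For i at least k, \<phi> n^k = \<phi> a^k = \<phi> a^k d a = 0, because \<phi> n^k d =
  0. For j at least s, \<psi> \<phi>^s = 0.\<close>

lemma n_phi_power_psi:
  assumes "i \<ge> k \<or> j \<ge> s"
  shows "n ^ i * (\<phi> ^ j * (\<phi> * \<psi>)) = 0"
  using assms
proof
  assume i: "i \<ge> k"
  have phi_n: "\<phi> * n ^ l = \<phi> * a ^ l" for l
  proof (induction l)
    case (Suc l)
    have "\<phi> * n ^ Suc l = n * (\<phi> * n ^ l)"
      using n_commute(1) by (simp add: mult.assoc[symmetric])
    also have "\<dots> = \<phi> * (a * a ^ l)"
      by (simp add: Suc n_commute(4) mult.assoc[symmetric])
    finally show ?case by simp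
  qed simp
  have phi_n_d: "\<phi> * (n ^ l * d) = 0" for l
    using n_eq by (cases l) (simp_all add: phi_d power_Suc2 mult.assoc dist da_simps del: power_Suc)
  have "\<phi> * a ^ k = \<phi> * (e * a ^ k * d * a)"
    using d'(5) by (simp add: mult.assoc[symmetric] e_phi)
  also have "\<dots> = \<phi> * a ^ k * d * a" by (simp add: mult.assoc[symmetric] e_phi)
  also have "\<dots> = 0" using phi_n_d[of k] by (simp add: phi_n[symmetric] mult.assoc mult_assoc_zero)
  finally have "\<phi> * n ^ k = 0" by (simp add: phi_n)
  then have 0: "\<phi> * n ^ i = 0"
    using i by (metis le_Suc_ex mult.assoc mult_zero_left power_add)
  have "n ^ i * (\<phi> ^ j * \<phi>) = \<phi> ^ j * \<phi> * n ^ i"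
    using commuting_power[of n "\<phi> ^ Suc j" i] commuting_power[of \<phi> n "Suc j"] n_commute(1)
    by (simp add: power_Suc2 del: power_Suc)
  also have "\<dots> = 0" using 0 by (simp add: mult.assoc)
  finally show ?thesis by (simp add: mult.assoc[symmetric])
next
  assume "j \<ge> s"
  then obtain l where "j = l + s" by (metis le_Suc_ex add.commute)
  then have "\<phi> ^ j * \<psi> = 0"
    using psi_phi_power_s by (simp add: power_add mult.assoc psi_phi_power)
  then have "\<phi> ^ j * (\<phi> * \<psi>) = 0"
    using power_commutes[of \<phi> j] by (metis mult.assoc mult_zero_right)
  then show ?thesis by simp
qed

lemma e_m: "e * m = a + b" "f * m = c"
proof -
  have "f * a = 0" "f * b = 0" "e * c = 0"
    using ef fe ea eb fc by (metis mult.assoc mult_zero_left)+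
  then show "e * m = a + b" "f * m = c"
    by (simp_all add: m_def dist ea eb fc)
qed

lemma c_e: "e * c = 0"
  using eq_zero_e_f[OF ee fc] .

lemma f_e_corner: "w * e = w \<Longrightarrow> w * f = 0" "e * w = w \<Longrightarrow> f * w = 0"
  "w * f = w \<Longrightarrow> w * e = 0" "f * w = w \<Longrightarrow> e * w = 0"
  using eq_zero_e_f[of w f] eq_zero_f_e[of f w] eq_zero_f_e[of w e] eq_zero_e_f[of e w] ee ff by auto

lemma e_y: "e * y = y" "y * e = y"
  by (simp_all add: y_def dist mult.assoc e_S S_e t' e_rho e_rho[THEN mult_assoc2])

lemma unit_m: "(e + f) * m = m" "m * (e + f) = m"
  by (simp_all add: m_def dist ea ae eb bf fc ce f_e_corner)

lemma unit_x: "(e + f) * x = x" "x * (e + f) = x"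
  by (simp_all add: x_def dist mult.assoc[symmetric] e_S S_e e_y eb fc c_e f_e_corner)
     (simp_all add: mult.assoc e_y bf f_e_corner)

text \<open>Since b = b f, only the second block row f m = c of m is seen, and b c = \<phi>.\<close>

lemma b_K: "b * (m ^ Suc j * K) = \<phi> * v j"
proof -
  have "b * (m ^ Suc j * K) = b * (f * m) * (m ^ j * K)"
    by (simp add: bf mult.assoc bf[THEN mult_assoc2])
  then show ?thesis
    by (simp add: e_m v_def mult.assoc b_c[THEN mult_assoc2] e_phi[THEN mult_assoc2])
qed

lemma v_Suc_Suc: "v (Suc (Suc j)) = a * v (Suc j) + \<phi> * v j"
proof -
  have "v (Suc (Suc j)) = (a + b) * (m ^ Suc j * K)"
    by (simp add: v_def mult.assoc[symmetric] e_m)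
  also have "\<dots> = a * v (Suc j) + \<phi> * v j"
    using b_K[of j] by (simp add: dist v_def mult.assoc ae[THEN mult_assoc2])
  finally show ?thesis .
qed

text \<open>Together with \<open>phi_b_K\<close> this supplies the two starting values of the
  recursion for \<phi> v j.\<close>

lemma phi_K: "\<phi> * K = \<phi> * \<psi>"
  using f_e_corner(1)[OF e_phi(2)]
  by (simp del: One_nat_def add: K_def m_x y_def rho_eq psi_eq dist mult.assoc nf_simps S_simps block_simps)

lemma phi_b_K: "\<phi> * (b * K) = \<phi> * (\<psi> * b)"
  using f_e_corner(3)[OF bf]
  by (simp del: One_nat_def add: K_def m_x y_def rho_eq psi_eq dist mult.assoc nf_simps S_simps block_simps bf)

lemma phi_v0: "\<phi> * v 0 = \<phi> * \<psi>"
  by (simp add: v_def phi_K e_phi[THEN mult_assoc2])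

lemma phi_v1: "\<phi> * v 1 = n * (\<phi> * \<psi>) + \<phi> * (\<psi> * b)"
  by (simp add: v_def e_m dist mult.assoc phi_b_K n_commute(4)[THEN mult_assoc2] phi_K)

lemma phi_power_n: "n ^ i * (\<phi> ^ l * (n * w)) = n ^ Suc i * (\<phi> ^ l * w)"
proof -
  have "\<phi> ^ l * n = n * \<phi> ^ l" using n_commute(1) by (intro commuting_power) simp
  from this[THEN mult_assoc2] show ?thesis
    by (simp add: power_Suc2 mult.assoc del: power_Suc)
qed

text \<open>By the recursion and \<phi> a = n \<phi>, each step trades one unit of j for a factor n
  or two units for a factor \<phi>. The weight i + 2 l + j is preserved, and for j = 0 or j = 1 its
  lower bound makes one of the two exponents large enough.\<close>

lemma phi_v_zero: "i + 2 * l + j \<ge> k + 2 * s \<Longrightarrow> n ^ i * (\<phi> ^ l * (\<phi> * v j)) = 0"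
proof (induction j arbitrary: i l rule: less_induct)
  case (less j)
  consider "j = 0" | "j = 1" | j' where "j = Suc (Suc j')"
    by (metis One_nat_def old.nat.exhaust)
  then show ?case
  proof cases
    case 1
    with less.prems have "i \<ge> k \<or> l \<ge> s" by linarith
    then show ?thesis using n_phi_power_psi 1 by (simp add: phi_v0)
  next
    case 2
    with less.prems have "Suc i \<ge> k \<or> l \<ge> s" "i \<ge> k \<or> l \<ge> s" by linarith+
    then have 0: "n ^ Suc i * (\<phi> ^ l * (\<phi> * \<psi>)) = 0" "n ^ i * (\<phi> ^ l * (\<phi> * \<psi>)) = 0"
      using n_phi_power_psi by blast+
    have "n ^ i * (\<phi> ^ l * (\<phi> * v j)) = n ^ i * (\<phi> ^ l * (n * (\<phi> * \<psi>))) + n ^ i * (\<phi> ^ l * (\<phi> * \<psi>)) * b"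
      by (simp add: 2 phi_v1[unfolded One_nat_def] dist mult.assoc)
    also have "n ^ i * (\<phi> ^ l * (n * (\<phi> * \<psi>))) = n ^ Suc i * (\<phi> ^ l * (\<phi> * \<psi>))"
      by (rule phi_power_n)
    finally show ?thesis using 0 by simp
  next
    case 3
    have "n ^ i * (\<phi> ^ l * (\<phi> * v j))
        = n ^ i * (\<phi> ^ l * (n * (\<phi> * v (Suc j')))) + n ^ i * (\<phi> ^ l * (\<phi> * (\<phi> * v j')))"
      by (simp add: 3 v_Suc_Suc dist mult.assoc n_commute(4)[THEN mult_assoc2])
    also have "n ^ i * (\<phi> ^ l * (n * (\<phi> * v (Suc j')))) = n ^ Suc i * (\<phi> ^ l * (\<phi> * v (Suc j')))"
      by (rule phi_power_n)
    also have "\<dots> = 0"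
      using less.prems 3 by (intro less.IH) auto
    also have "n ^ i * (\<phi> ^ l * (\<phi> * (\<phi> * v j'))) = n ^ i * (\<phi> ^ Suc l * (\<phi> * v j'))"
      by (simp add: power_Suc2 mult.assoc del: power_Suc)
    also have "\<dots> = 0"
      using less.prems 3 by (intro less.IH) auto
    finally show ?thesis by simp
  qed
qed

lemma phi_v: "j \<ge> k + 2 * s \<Longrightarrow> \<phi> * v j = 0"
  using phi_v_zero[of 0 0 j] by simp

lemma x_K: "x * (m ^ j * K) = 0"
proof -
  have "x * m ^ j = m ^ j * x"
    by (rule commuting_power[symmetric]) (simp add: m_x x_m)
  then have "x * (m ^ j * K) = m ^ j * (x * K)" by (metis mult.assoc)
  moreover have "x * K = x * (e + f) - x * m * x"
    by (simp only: K_def right_diff_distrib mult.assoc)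
  ultimately show ?thesis by (simp add: unit_x x_m_x)
qed

lemma e_x: "e * x = S 1 + y * b"
  by (simp add: x_def dist mult.assoc[symmetric] e_S e_y c_e)

text \<open>The first block row of x m^j K = 0 reads S 1 v j + y \<phi> v (j - 1) = 0. The second
  summand vanishes, which costs one in the bound, and S 1 = S 3 \<phi> + d (e - t \<phi>) acts on v
  j as d.\<close>

lemma d_v: "j \<ge> Suc (k + 2 * s) \<Longrightarrow> d * v j = 0"
proof -
  assume j: "j \<ge> Suc (k + 2 * s)"
  then obtain l where l: "j = Suc l" "l \<ge> k + 2 * s" by (cases j) auto
  have "0 = e * x * (m ^ j * K)" using x_K by (simp add: mult.assoc)
  also have "\<dots> = S 1 * (m ^ j * K) + y * (\<phi> * v l)"
    using b_K[of l] by (simp add: e_x dist l mult.assoc)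
  also have "\<dots> = S 1 * v j"
    using phi_v l S_e[THEN mult_assoc2] by (simp add: v_def mult.assoc)
  also have "S 1 = S 3 * \<phi> + d * (e - t * \<phi>)"
    by (simp only: S3_phi psi_eq) simp
  also have "\<dots> * v j = d * v j"
    using phi_v[of j] j by (simp add: dist mult.assoc da_simps)
  finally show ?thesis by simp
qed

lemma v_zero: "j \<ge> 2 * k + 2 * s + 2 \<Longrightarrow> v j = 0"
proof -
  assume j: "j \<ge> 2 * k + 2 * s + 2"
  \<comment> \<open>Beyond this point the \<phi> term of the recursion is zero, so v evolves by left
    multiplication with a alone.\<close>
  have step: "v (k + 2 * s + 2 + i) = a ^ i * v (k + 2 * s + 2)" for i
  proof (induction i)
    case (Suc i)
    then show ?case
      using v_Suc_Suc[of "k + 2 * s + 1 + i"] phi_v[of "k + 2 * s + 1 + i"]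
      by (simp add: mult.assoc)
  qed simp
  define w where "w = v (k + 2 * s + 2)"
  have w: "e * w = w" "d * w = 0"
    using d_v[of "k + 2 * s + 2"] by (simp_all add: w_def v_def mult.assoc[symmetric] ee)
  have "a ^ k * w = e * a ^ k * w"
    using w(1) commuting_power[of a e k] ea ae by (metis mult.assoc)
  also have "\<dots> = e * a ^ k * d * a * w" by (simp only: d'(5))
  also have "\<dots> = 0"
    using w(2) d'(3) by (metis mult.assoc mult_zero_right)
  finally have "a ^ i * (a ^ k * w) = 0" for i by simp
  then have "v (k + 2 * s + 2 + (i + k)) = 0" for i
    by (simp only: step power_add mult.assoc w_def)
  moreover obtain i where "j = k + 2 * s + 2 + (i + k)"
    using j by (metis le_Suc_ex add.commute add.left_commute mult_2)
  ultimately show ?thesis by simp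
qed

text \<open>The second block row of m^(j+1) K is c v j, so one more power than for the first row
  suffices.\<close>

lemma m_power_K: "m ^ (2 * k + 2 * s + 3) * K = 0"
proof -
  define j where "j = 2 * k + 2 * s + 2"
  have "m ^ Suc j * K = (e + f) * (m * (m ^ j * K))"
    using unit_m(1) by (simp add: mult.assoc[symmetric])
  also have "\<dots> = v (Suc j) + c * v j"
    by (simp add: v_def dist mult.assoc e_m(2)[THEN mult_assoc2] ce[THEN mult_assoc2])
  also have "\<dots> = 0" by (simp add: v_zero j_def)
  finally show ?thesis by (simp add: j_def numeral_eq_Suc)
qed

text \<open>The index is only a convenient exponent at which m^N K = 0; uniqueness across indices
  makes its exact value irrelevant.\<close>

theorem drazin_wrt_x: "drazin_wrt (e + f) (2 * k + 2 * s + 3) m x"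
proof -
  define N where "N = 2 * k + 2 * s + 3"
  have "m ^ N * K = m ^ N * (e + f) - m ^ N * x * m"
    by (simp only: K_def right_diff_distrib mult.assoc m_x x_m)
  moreover have "m ^ N * (e + f) = (e + f) * m ^ N"
    by (rule commuting_power) (simp only: unit_m)
  ultimately have "m ^ N * x * m = (e + f) * m ^ N"
    using m_power_K[folded N_def] by simp
  moreover have "(e + f) * ((e + f) * m ^ N) = (e + f) * m ^ N"
    by (simp add: dist mult.assoc[symmetric] ee ff ef fe)
  ultimately have "(e + f) * m ^ N * x * m = (e + f) * m ^ N"
    by (metis mult.assoc)
  then show ?thesis
    using unit_x x_m_x m_x x_m by (simp add: drazin_wrt_def N_def)
qed

section \<open>Collapse of the four displayed blocks\<close>

lemma block_11:
  "(\<Sum>i<s. d ^ (2 * i + 2) * \<psi> * \<phi> ^ i * a) - d * (\<phi> * t)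
    + (\<Sum>i<s. d ^ (2 * i + 3) * \<psi> * \<phi> ^ (i + 1)) = S 1"
proof -
  have "(\<Sum>i<s. d ^ (2 * i + 2) * \<psi> * \<phi> ^ i * a) = S 2 * a"
    "(\<Sum>i<s. d ^ (2 * i + 3) * \<psi> * \<phi> ^ (i + 1)) = S 3 * \<phi>"
    by (simp_all add: S_def sum_distrib_right mult.assoc power_commutes)
  \<comment> \<open>Here S 2 a = d and S 3 \<phi> = S 1 - d \<psi>; as d \<psi> = d - d \<phi> t,
    everything but S 1 cancels.\<close>
  then show ?thesis
    by (simp del: One_nat_def add: S_rules psi_eq dist da_simps)
qed

lemma block_12: "(\<Sum>i<s. d ^ (2 * i + 2) * \<psi> * \<phi> ^ i * b) + \<rho> * t * b = y * b"
  by (simp add: y_def S_def sum_distrib_right distrib_right)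

lemma block_21:
  "(\<Sum>i<s. c * d ^ (2 * i + 3) * \<psi> * \<phi> ^ i * a) - c * d ^ 2 * (\<phi> * t)
    + (\<Sum>i<s. c * d ^ (2 * i + 4) * \<psi> * \<phi> ^ (i + 1)) + c * \<rho> * t = c * y"
proof -
  have "(\<Sum>i<s. c * d ^ (2 * i + 3) * \<psi> * \<phi> ^ i * a) = c * (S 3 * a)"
    "(\<Sum>i<s. c * d ^ (2 * i + 4) * \<psi> * \<phi> ^ (i + 1)) = c * (S 4 * \<phi>)"
    by (simp_all add: S_def sum_distrib_right sum_distrib_left mult.assoc power_commutes)
  then show ?thesis
    by (simp del: One_nat_def add: S_rules psi_eq y_def power2_eq_square dist mult.assoc da_simps)
qed

lemma block_22:
  "(\<Sum>i<s. c * d ^ (2 * i + 3) * \<psi> * \<phi> ^ i * b) - c * a * \<rho> * t ^ 2 * b - c * d * t * b = c * z * b"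
  by (simp add: z_def n_def S_def sum_distrib_right sum_distrib_left dist mult.assoc)

end

section \<open>Existence of complex and dual Drazin inverses\<close>

lemma eventually_constant_nat:
  fixes r :: "nat \<Rightarrow> nat"
  assumes "\<And>j. r (Suc j) \<le> r j"
  obtains j where "r (Suc j) = r j"
proof -
  obtain j where "\<And>i. r j \<le> r i" using ex_has_least_nat[of "\<lambda>_. True" _ r] by auto
  then show thesis using that assms by (meson le_antisym)
qed

lemma pow_mat_Suc_left:
  fixes A :: "'a::semiring_1 mat"
  assumes "A \<in> carrier_mat n n"
  shows "A ^\<^sub>m Suc k = A * A ^\<^sub>m k"
proof (induction k)
  case (Suc k)
  have "A ^\<^sub>m Suc (Suc k) = A * A ^\<^sub>m k * A" using Suc by simp
  also have "\<dots> = A * A ^\<^sub>m Suc k" using assms by (simp add: assoc_mult_mat[of _ n n _ n _ n])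
  finally show ?case .
qed (use assms in simp)

lemma transpose_pow_mat:
  fixes A :: "'a::comm_semiring_1 mat"
  assumes "A \<in> carrier_mat n n"
  shows "(A ^\<^sub>m k)\<^sup>T = A\<^sup>T ^\<^sub>m k"
proof (induction k)
  case (Suc k)
  have "(A ^\<^sub>m Suc k)\<^sup>T = A\<^sup>T * (A ^\<^sub>m k)\<^sup>T"
    using assms by (simp add: transpose_mult[of _ n n _ n])
  then show ?case using Suc pow_mat_Suc_left[of "A\<^sup>T" n k] assms by simp
qed (use assms in auto)

lemma pow_mat_rank_factor:
  fixes A :: "'a::field mat"
  assumes A: "A \<in> carrier_mat n n"
  shows "\<exists>k. vec_space.rank n (A ^\<^sub>m k) = vec_space.rank n (A ^\<^sub>m (k + 1))"
    and "vec_space.rank n (A ^\<^sub>m k) = vec_space.rank n (A ^\<^sub>m (k + 1)) \<Longrightarrow>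
      \<exists>U\<in>carrier_mat n n. A ^\<^sub>m k = A ^\<^sub>m Suc k * U"
proof -
  have "vec_space.rank n (A ^\<^sub>m Suc j) \<le> vec_space.rank n (A ^\<^sub>m j)" for j
    using rank_mult_le(1)[OF pow_carrier_mat[OF A] A] by simp
  then show "\<exists>k. vec_space.rank n (A ^\<^sub>m k) = vec_space.rank n (A ^\<^sub>m (k + 1))"
    using eventually_constant_nat[of "\<lambda>j. vec_space.rank n (A ^\<^sub>m j)"] by (metis Suc_eq_plus1)
  show "\<exists>U\<in>carrier_mat n n. A ^\<^sub>m k = A ^\<^sub>m Suc k * U"
    if "vec_space.rank n (A ^\<^sub>m k) = vec_space.rank n (A ^\<^sub>m (k + 1))"
    using rank_mult_le(2)[OF pow_carrier_mat[OF A] A, of k] that by simp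
qed

section \<open>Transfer between matrices and corner rings\<close>

lemma blk_one_idem: "blk p p (1\<^sub>m n) * blk p p (1\<^sub>m n) = blk p p (1\<^sub>m n)"
  by (simp add: blk_mult[of _ n n _ n])

lemma blk_one_left: "A \<in> carrier_mat n l \<Longrightarrow> blk p p (1\<^sub>m n) * blk p q A = blk p q A"
  and blk_one_right: "A \<in> carrier_mat l n \<Longrightarrow> blk q p A * blk p p (1\<^sub>m n) = blk q p A"
  by (simp_all add: blk_mult[of _ n n _ l] blk_mult[of _ l n _ n])

lemma is_drazin_inverse_blk:
  assumes "A \<in> carrier_mat n n" "X \<in> carrier_mat n n"
  shows "is_drazin_inverse k A X \<longleftrightarrow>
    drazin_wrt (blk p p (1\<^sub>m n)) k (blk p p A) (blk p p X)"
proof -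
  have eq: "Y = Z \<longleftrightarrow> blk p p Y = blk p p Z" if "Y \<in> carrier_mat n n" "Z \<in> carrier_mat n n"
    for Y Z :: "'a mat"
    using blk_inject that by blast
  have c: "A ^\<^sub>m k * X * A \<in> carrier_mat n n" "A ^\<^sub>m k \<in> carrier_mat n n"
    "X * A * X \<in> carrier_mat n n" "A * X \<in> carrier_mat n n" "X * A \<in> carrier_mat n n"
    "A ^\<^sub>m k * X \<in> carrier_mat n n"
    using assms by auto
  show ?thesis
    unfolding is_drazin_inverse_def drazin_wrt_def eq[OF c(1,2)] eq[OF c(3) assms(2)] eq[OF c(4,5)]
    using assms c
    by (simp add: blk_mult[of _ n n _ n p p p, symmetric] blk_pow[of _ n]
        blk_one_left[of _ n n] blk_one_right[of _ n n] mult.assoc del: assoc_mult_mat)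
qed

lemma is_drazin_inverse_unique:
  fixes A :: "'a::comm_ring_1 mat"
  assumes A: "A \<in> carrier_mat n n"
    and X: "is_drazin_inverse k A X" and Y: "is_drazin_inverse l A Y"
  shows "X = Y"
proof -
  have c: "X \<in> carrier_mat n n" "Y \<in> carrier_mat n n"
    using A X Y by (auto simp: is_drazin_inverse_def)
  have "blk 0 0 X = blk 0 0 Y"
    using X Y by - (rule drazin_wrt_unique[of "blk 0 0 (1\<^sub>m n)" k "blk 0 0 A" _ l],
      simp_all add: is_drazin_inverse_blk[OF A, where p = 0] A c blk_one_left[of _ n n] blk_one_right[of _ n n])
  then show ?thesis using blk_inject c by blast
qed

lemma is_drazin_inverse_exists:
  fixes A :: "'a::comm_ring_1 mat"
  assumes c: "A \<in> carrier_mat n n" "U \<in> carrier_mat n n" "W \<in> carrier_mat n n"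
    and "A ^\<^sub>m k = A ^\<^sub>m Suc k * U" "A ^\<^sub>m k = W * A ^\<^sub>m Suc k"
  shows "is_drazin_inverse k A (A ^\<^sub>m k * U ^\<^sub>m Suc k)"
proof -
  let ?e = "blk 0 0 (1\<^sub>m n) :: 'a seq_endo"
  have 1: "blk 0 0 (A ^\<^sub>m k) = blk 0 0 (A ^\<^sub>m Suc k) * blk 0 0 U"
    "blk 0 0 (A ^\<^sub>m k) = blk 0 0 W * blk 0 0 (A ^\<^sub>m Suc k)"
    using assms by (simp_all add: blk_mult[of _ n n _ n] del: pow_mat.simps)
  have W: "blk 0 0 W * ?e = blk 0 0 W" using c by (simp add: blk_one_right)
  have "drazin_wrt ?e k (blk 0 0 A) (?e * blk 0 0 A ^ k * blk 0 0 U ^ Suc k)"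
    using 1 W c unfolding blk_pow[OF c(1)] mult.assoc[symmetric]
    by (intro drazin_wrt_exists[where w = "blk 0 0 W"])
      (simp_all add: blk_one_idem blk_one_left blk_one_right del: power_Suc)
  moreover have "?e * blk 0 0 A ^ k * blk 0 0 U ^ Suc k = blk 0 0 (A ^\<^sub>m k) * blk 0 0 (U ^\<^sub>m Suc k)"
    unfolding blk_pow[OF c(1)] blk_pow[OF c(2)] using c
    by (simp add: mult.assoc[symmetric] blk_one_left)
  moreover have "blk 0 0 (A ^\<^sub>m k) * blk 0 0 (U ^\<^sub>m Suc k) = blk 0 0 (A ^\<^sub>m k * U ^\<^sub>m Suc k)"
    by (rule blk_mult[of _ n n _ n]) (use c in \<open>simp_all del: pow_mat.simps\<close>)
  moreover have "A ^\<^sub>m k * U ^\<^sub>m Suc k \<in> carrier_mat n n"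
    by (rule mult_carrier_mat[of _ n n]) (use c in \<open>simp_all del: pow_mat.simps\<close>)
  ultimately show ?thesis using is_drazin_inverse_blk[OF c(1)] by metis
qed

text \<open>Equality of ranks gives a right factor U at exponent k. The same argument for the
  transpose gives a left factor at some exponent r. Both hold at r + k, which yields a Drazin
  inverse of that index.\<close>

lemma complex_drazin_exists:
  fixes A :: "complex mat"
  assumes A: "A \<in> carrier_mat n n"
  shows "\<exists>X. is_drazin_inverse (mat_ind A) A X"
proof -
  define k where "k = mat_ind A"
  have "vec_space.rank n (A ^\<^sub>m k) = vec_space.rank n (A ^\<^sub>m (k + 1))"
    using pow_mat_rank_factor(1)[OF A] A unfolding k_def mat_ind_def by (auto intro: LeastI_ex)
  then obtain U where U: "U \<in> carrier_mat n n" "A ^\<^sub>m k = A ^\<^sub>m Suc k * U"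
    using pow_mat_rank_factor(2)[OF A] by blast
  have "A\<^sup>T \<in> carrier_mat n n" using A by simp
  then obtain r V where V: "V \<in> carrier_mat n n" "A\<^sup>T ^\<^sub>m r = A\<^sup>T ^\<^sub>m Suc r * V"
    using pow_mat_rank_factor by metis
  have "A ^\<^sub>m r = (A\<^sup>T ^\<^sub>m r)\<^sup>T" using transpose_pow_mat[OF A, of r] by (metis transpose_transpose)
  also have "\<dots> = V\<^sup>T * (A\<^sup>T ^\<^sub>m Suc r)\<^sup>T"
    unfolding V(2) using A V(1) by (intro transpose_mult) (auto simp del: pow_mat.simps)
  also have "\<dots> = V\<^sup>T * A ^\<^sub>m Suc r"
    by (metis transpose_pow_mat[OF A] transpose_transpose)
  finally have W: "A ^\<^sub>m r = V\<^sup>T * A ^\<^sub>m Suc r" .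
  let ?e = "blk 0 0 (1\<^sub>m n) :: complex seq_endo" and ?a = "blk 0 0 A"
  have pow_add: "A ^\<^sub>m (i + j) = A ^\<^sub>m i * A ^\<^sub>m j" for i j
  proof (induction j)
    case (Suc j) then show ?case using A by (simp add: assoc_mult_mat[of _ n n _ n _ n])
  qed (use A in simp)
  have 1: "A ^\<^sub>m (r + k) = A ^\<^sub>m Suc (r + k) * U"
  proof -
    have "A ^\<^sub>m (r + k) = A ^\<^sub>m r * (A ^\<^sub>m Suc k * U)" unfolding pow_add U(2)[symmetric] ..
    also have "\<dots> = A ^\<^sub>m (r + Suc k) * U" unfolding pow_add[of r] using A U(1)
      by (intro assoc_mult_mat[symmetric]) (auto simp del: pow_mat.simps)
    finally show ?thesis by simp
  qed
  have 2: "A ^\<^sub>m (r + k) = V\<^sup>T * A ^\<^sub>m Suc (r + k)"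
  proof -
    have "A ^\<^sub>m (r + k) = (V\<^sup>T * A ^\<^sub>m Suc r) * A ^\<^sub>m k" unfolding pow_add W[symmetric] ..
    also have "\<dots> = V\<^sup>T * A ^\<^sub>m (Suc r + k)" unfolding pow_add[of "Suc r"] using A V(1)
      by (intro assoc_mult_mat) (auto simp del: pow_mat.simps)
    finally show ?thesis by simp
  qed
  define X where "X = A ^\<^sub>m (r + k) * U ^\<^sub>m Suc (r + k)"
  have X: "is_drazin_inverse (r + k) A X" unfolding X_def
    using is_drazin_inverse_exists[OF A U(1) _ 1 2] V(1) by simp
  then have Xc: "X \<in> carrier_mat n n" using A by (simp add: is_drazin_inverse_def)
  have D: "drazin_wrt ?e (r + k) ?a (blk 0 0 X)"
    using X is_drazin_inverse_blk[OF A Xc] by blast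
  have "blk 0 0 (A ^\<^sub>m k) = blk 0 0 (A ^\<^sub>m Suc k) * blk 0 0 U"
    using U A by (simp add: blk_mult[of _ n n _ n] del: pow_mat.simps)
  then have "?e * ?a ^ k = ?e * ?a ^ Suc k * blk 0 0 U"
    by (simp only: blk_pow[OF A])
  \<comment> \<open>The right factor U at exponent k lowers the index from r + k to k.\<close>
  then have "drazin_wrt ?e k ?a (blk 0 0 X)"
    using A by (intro drazin_wrt_index[OF D]) (simp_all only: blk_one_left blk_one_right)
  then have "is_drazin_inverse k A X"
    using is_drazin_inverse_blk[OF A Xc] by blast
  then show ?thesis unfolding k_def ..
qed

section \<open>Standard and infinitesimal parts of dual matrices\<close>

lemma std_part_simps [simp]:
  "std_part (0 :: 'a::comm_ring_1 dual_number) = 0" "inf_part (0 :: 'a dual_number) = 0"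
  "std_part (1 :: 'a dual_number) = 1" "inf_part (1 :: 'a dual_number) = 0"
  "std_part (x + y) = std_part x + std_part y" "inf_part (x + y) = inf_part x + inf_part y"
  "std_part (x * y) = std_part x * std_part y"
  "inf_part (x * y) = std_part x * inf_part y + inf_part x * std_part y"
  for x y :: "'a::comm_ring_1 dual_number"
  by (simp_all add: zero_dual_number_def one_dual_number_def plus_dual_number_def times_dual_number_def)

lemma std_part_sum: "std_part (\<Sum>i\<in>I. g i) = (\<Sum>i\<in>I. std_part (g i))"
  and inf_part_sum: "inf_part (\<Sum>i\<in>I. g i) = (\<Sum>i\<in>I. inf_part (g i))"
  for g :: "'b \<Rightarrow> 'a::comm_ring_1 dual_number"
  by (induction I rule: infinite_finite_induct) auto

lemma std_mat_carrier [simp]: "std_mat A \<in> carrier_mat n l \<longleftrightarrow> A \<in> carrier_mat n l"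
  and inf_mat_carrier [simp]: "inf_mat A \<in> carrier_mat n l \<longleftrightarrow> A \<in> carrier_mat n l"
  by (simp_all add: std_mat_def inf_mat_def)

lemma std_mat_one: "std_mat (1\<^sub>m n) = 1\<^sub>m n" and inf_mat_one: "inf_mat (1\<^sub>m n) = 0\<^sub>m n n"
  by (auto simp: std_mat_def inf_mat_def)

lemma std_mat_mult:
  "A \<in> carrier_mat n l \<Longrightarrow> B \<in> carrier_mat l r \<Longrightarrow> std_mat (A * B) = std_mat A * std_mat B"
  by (rule eq_matI) (auto simp: std_mat_def scalar_prod_def std_part_sum)

lemma inf_mat_mult:
  "A \<in> carrier_mat n l \<Longrightarrow> B \<in> carrier_mat l r \<Longrightarrow>
    inf_mat (A * B) = std_mat A * inf_mat B + inf_mat A * std_mat B"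
  by (rule eq_matI) (auto simp: std_mat_def inf_mat_def scalar_prod_def inf_part_sum sum.distrib)

lemma dc_mat_eqI:
  assumes "A \<in> carrier_mat n l" "B \<in> carrier_mat n l" "std_mat A = std_mat B" "inf_mat A = inf_mat B"
  shows "A = B"
proof (rule eq_matI)
  fix i j assume ij: "i < dim_row B" "j < dim_col B"
  have "std_mat A $$ (i, j) = std_mat B $$ (i, j)" "inf_mat A $$ (i, j) = inf_mat B $$ (i, j)"
    using assms by simp_all
  then show "A $$ (i, j) = B $$ (i, j)"
    using ij assms(1,2) by (cases "A $$ (i, j)"; cases "B $$ (i, j)") (auto simp: std_mat_def inf_mat_def)
qed (use assms in auto)

lemma dc_mat_parts:
  assumes "X \<in> carrier_mat n l" "Y \<in> carrier_mat n l"
  obtains A where "A \<in> carrier_mat n l" "std_mat A = X" "inf_mat A = Y"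
proof
  show "mat n l (\<lambda>ij. Dual (X $$ ij) (Y $$ ij)) \<in> carrier_mat n l" by simp
  show "std_mat (mat n l (\<lambda>ij. Dual (X $$ ij) (Y $$ ij))) = X"
    "inf_mat (mat n l (\<lambda>ij. Dual (X $$ ij) (Y $$ ij))) = Y"
    using assms by (auto simp: std_mat_def inf_mat_def)
qed

lemma std_mat_pow:
  assumes "A \<in> carrier_mat n n"
  shows "std_mat (A ^\<^sub>m k) = std_mat A ^\<^sub>m k"
proof (induction k)
  case 0
  then show ?case using assms by (simp add: std_mat_one)
next
  case (Suc k)
  then show ?case using assms by (simp add: std_mat_mult[of _ n n _ n])
qed

text \<open>The product rule for A^k A and for A A^k, and its iteration. The resulting sum is the
  one in the definition of \<open>DCz\<close>, whose condition thus concerns the infinitesimal part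
  of A^k.\<close>

lemma blk_inf_mat_pow:
  assumes A: "A \<in> carrier_mat n n"
  defines "e \<equiv> blk 0 0 (1\<^sub>m n)" and "a \<equiv> blk 0 0 (std_mat A)" and "a\<^sub>0 \<equiv> blk 0 0 (inf_mat A)"
  shows "blk 0 0 (inf_mat (A ^\<^sub>m Suc k)) = e * a ^ k * a\<^sub>0 + blk 0 0 (inf_mat (A ^\<^sub>m k)) * a"
    and "blk 0 0 (inf_mat (A ^\<^sub>m Suc k)) = a * blk 0 0 (inf_mat (A ^\<^sub>m k)) + a\<^sub>0 * (e * a ^ k)"
    and "blk 0 0 (inf_mat (A ^\<^sub>m k)) = (\<Sum>i\<in>{1..k}. e * a ^ (k - i) * a\<^sub>0 * (e * a ^ (i - 1)))"
proof -
  have *: "blk 0 0 (inf_mat (X * Y)) = blk 0 0 (std_mat X) * blk 0 0 (inf_mat Y)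
      + blk 0 0 (inf_mat X) * blk 0 0 (std_mat Y)"
    if "X \<in> carrier_mat n n" "Y \<in> carrier_mat n n" for X Y
    using that by (simp add: inf_mat_mult[of _ n n _ n] blk_add[of _ n n] blk_mult[of _ n n _ n])
  show 1: "blk 0 0 (inf_mat (A ^\<^sub>m Suc k)) = e * a ^ k * a\<^sub>0 + blk 0 0 (inf_mat (A ^\<^sub>m k)) * a" for k
    using A by (simp add: * std_mat_pow[OF A] blk_pow[of _ n] e_def a_def a\<^sub>0_def)
  show "blk 0 0 (inf_mat (A ^\<^sub>m Suc k)) = a * blk 0 0 (inf_mat (A ^\<^sub>m k)) + a\<^sub>0 * (e * a ^ k)"
    using A unfolding pow_mat_Suc_left[OF A] by (simp add: * std_mat_pow[OF A] blk_pow[of _ n] e_def a_def a\<^sub>0_def)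
  have a: "e * a = a" "a * e = a" "a\<^sub>0 * e = a\<^sub>0" using A by (simp_all add: e_def a_def a\<^sub>0_def blk_one_left blk_one_right)
  show "blk 0 0 (inf_mat (A ^\<^sub>m k)) = (\<Sum>i\<in>{1..k}. e * a ^ (k - i) * a\<^sub>0 * (e * a ^ (i - 1)))"
  proof (induction k)
    case 0
    have "dim_row A = n" using A by simp
    then show ?case by (simp add: inf_mat_one)
  next
    case (Suc k)
    have "(\<Sum>i\<in>{1..k}. e * a ^ (k - i) * a\<^sub>0 * (e * a ^ (i - 1))) * a
        = (\<Sum>i\<in>{1..k}. e * a ^ (Suc k - Suc i) * a\<^sub>0 * (e * a ^ (Suc i - 1)))"
      unfolding sum_distrib_right
    proof (intro sum.cong refl)
      fix i assume "i \<in> {1..k}"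
      \<comment> \<open>Indices start at 1, so i - 1 is not truncated.\<close>
      then have "a ^ (i - 1) * a = a ^ i" by (cases i) (simp_all add: power_commutes)
      then show "e * a ^ (k - i) * a\<^sub>0 * (e * a ^ (i - 1)) * a
          = e * a ^ (Suc k - Suc i) * a\<^sub>0 * (e * a ^ (Suc i - 1))"
        by (simp add: mult.assoc)
    qed
    also have "\<dots> = (\<Sum>i\<in>{Suc 1..Suc k}. e * a ^ (Suc k - i) * a\<^sub>0 * (e * a ^ (i - 1)))"
      by (simp only: sum.atLeast_Suc_atMost_Suc_shift comp_def)
    finally have "blk 0 0 (inf_mat (A ^\<^sub>m k)) * a
        = (\<Sum>i\<in>{Suc 1..Suc k}. e * a ^ (Suc k - i) * a\<^sub>0 * (e * a ^ (i - 1)))"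
      by (simp only: Suc)
    then show ?case
      unfolding 1 by (subst sum.atLeast_Suc_atMost) (simp_all add: a mult.assoc)
  qed
qed

lemma drazin_wrt_power:
  assumes x: "drazin_wrt e k a x" and ea: "e * a = a" "a * e = a"
  shows "e * a ^ Suc l * x ^ Suc l = a * x" "x ^ Suc l * (e * a ^ Suc l) = a * x"
proof -
  have x1: "x * a * x = x" "a * x = x * a" "e * x = x" "x * e = x" using x by (auto simp: drazin_wrt_def)
  have "(a * x) * (a * x) = a * x" using x1 by (metis mult.assoc)
  then have ax: "(a * x) ^ Suc l = a * x" using idem_power[of "a * x" "Suc l"] by simp
  have "a ^ Suc l * x ^ Suc l = a * x"
    using commuting_power_mult[OF x1(2), of "Suc l"] ax by (simp only:)
  then show "e * a ^ Suc l * x ^ Suc l = a * x"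
    using ea by (simp add: mult.assoc[symmetric])
  have "x ^ Suc l * a ^ Suc l = a * x"
    using commuting_power_mult[OF x1(2)[symmetric], of "Suc l"] ax x1(2) by (simp only:)
  moreover have "e * a ^ Suc l = a ^ Suc l" using ea by (simp add: mult.assoc[symmetric])
  ultimately show "x ^ Suc l * (e * a ^ Suc l) = a * x" by (simp only:)
qed

text \<open>Here \<open>u\<close> and \<open>u'\<close> play the role of the infinitesimal parts of \<open>(s + \<epsilon> s\<^sub>0)\<^sup>k\<close> and \<open>(s + \<epsilon> s\<^sub>0)\<^bsup>k+1\<^esup>\<close>.\<close>

lemma dual_power_factor:
  fixes e s x s\<^sub>0 u u' :: "'a::ring_1"
  assumes x: "drazin_wrt e k s x" and ea: "e * s = s" "s * e = s"
    and e: "e * e = e" "e * u = u" "u * e = u" "e * s\<^sub>0 = s\<^sub>0" "s\<^sub>0 * e = s\<^sub>0"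
    and zero: "(e - s * x) * u * (e - s * x) = 0"
  shows "u' = e * s ^ k * s\<^sub>0 + u * s \<Longrightarrow>
      u = e * s ^ Suc k * (x ^ Suc k * u * (e - s * x) - x * s\<^sub>0 * x) + u' * x"
    and "u' = s * u + s\<^sub>0 * (e * s ^ k) \<Longrightarrow>
      u = x * u' + ((e - s * x) * u * x ^ Suc k - x * s\<^sub>0 * x) * (e * s ^ Suc k)"
proof -
  have x1: "s * x = x * s" "e * s ^ k * x * s = e * s ^ k" using x by (auto simp: drazin_wrt_def)
  have sx: "e * s ^ Suc k * x = e * s ^ k"
  proof -
    have "e * s ^ Suc k * x = e * s ^ k * (s * x)" by (simp add: power_Suc2 mult.assoc del: power_Suc)
    then show ?thesis using x1 by (simp add: mult.assoc)
  qed
  have xs: "x * (e * s ^ Suc k) = e * s ^ k"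
  proof -
    have "e * s ^ Suc k = s ^ Suc k" using ea by (simp add: mult.assoc[symmetric])
    moreover have "s ^ Suc k * x = x * s ^ Suc k" using x1(1) by (rule commuting_power)
    ultimately show ?thesis using sx by simp
  qed
  \<comment> \<open>Expanding the vanishing corner expresses u through terms that contain the
    idempotent s x on at least one side.\<close>
  have z: "u = s * x * u + u * s * x - s * x * u * (s * x)"
    using zero e by (simp add: left_diff_distrib right_diff_distrib mult.assoc) (simp add: algebra_simps)
  note p = drazin_wrt_power[OF x ea, of k]
  \<comment> \<open>The bracket solves the equation: s^(k+1) x^(k+1) = s x recovers the part s x u
    (e - s x), and the term - x s0 x cancels what the product rule contributes through u'.\<close>
  show "u = e * s ^ Suc k * (x ^ Suc k * u * (e - s * x) - x * s\<^sub>0 * x) + u' * x"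
    if u': "u' = e * s ^ k * s\<^sub>0 + u * s"
  proof -
    have "e * s ^ Suc k * (x ^ Suc k * u * (e - s * x) - x * s\<^sub>0 * x) + u' * x
        = (e * s ^ Suc k * x ^ Suc k) * u * (e - s * x) - (e * s ^ Suc k * x) * s\<^sub>0 * x
          + e * s ^ k * s\<^sub>0 * x + u * s * x"
      unfolding u' by (simp only: right_diff_distrib distrib_right mult.assoc add.assoc)
    also have "\<dots> = s * x * u * (e - s * x) + u * s * x"
      unfolding p sx by simp
    also have "\<dots> = s * x * u + u * s * x - s * x * u * (s * x)"
      using e by (simp add: right_diff_distrib mult.assoc)
    finally show ?thesis using z by simp
  qed
  show "u = x * u' + ((e - s * x) * u * x ^ Suc k - x * s\<^sub>0 * x) * (e * s ^ Suc k)"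
    if u': "u' = s * u + s\<^sub>0 * (e * s ^ k)"
  proof -
    have "x * u' + ((e - s * x) * u * x ^ Suc k - x * s\<^sub>0 * x) * (e * s ^ Suc k)
        = x * s * u + x * s\<^sub>0 * (e * s ^ k) + (e - s * x) * u * (x ^ Suc k * (e * s ^ Suc k))
          - x * s\<^sub>0 * (x * (e * s ^ Suc k))"
      unfolding u' by (simp only: left_diff_distrib distrib_left mult.assoc add.assoc) simp
    also have "\<dots> = s * x * u + (e - s * x) * u * (s * x)"
      unfolding p xs x1(1) by simp
    also have "\<dots> = s * x * u + u * s * x - s * x * u * (s * x)"
      using e by (simp add: left_diff_distrib mult.assoc)
    finally show ?thesis using z by simp
  qed
qed

lemma dual_drazin_exists:
  assumes "A \<in> DCz n"
  shows "\<exists>X. is_drazin_inverse (ind_s A) A X"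
proof -
  define S where "S = std_mat A"
  define S\<^sub>0 where "S\<^sub>0 = inf_mat A"
  define k where "k = mat_ind S"
  have A: "A \<in> carrier_mat n n" using assms by (simp add: DCz_def)
  have c: "S \<in> carrier_mat n n" "S\<^sub>0 \<in> carrier_mat n n" using A by (simp_all add: S_def S\<^sub>0_def)
  obtain X where X: "is_drazin_inverse k S X" using complex_drazin_exists[OF c(1)] k_def by blast
  then have dX: "drazin S = X"
    unfolding drazin_def k_def[symmetric] using is_drazin_inverse_unique[OF c(1)] by blast
  have Xc: "X \<in> carrier_mat n n" using X c by (simp add: is_drazin_inverse_def)
  define P where "P = 1\<^sub>m n - S * X"
  define T where "T = inf_mat (A ^\<^sub>m k)"
  have Pc: "P \<in> carrier_mat n n" and Tc: "T \<in> carrier_mat n n"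
    using c Xc A by (auto simp: P_def T_def)
  let ?Q = "mat_sum n n (\<lambda>i. S ^\<^sub>m (k - i) * S\<^sub>0 * S ^\<^sub>m (i - 1)) {1..k}"
  have Qc: "?Q \<in> carrier_mat n n" by (simp add: mat_sum_def)
  have PQP: "P * ?Q * P = 0\<^sub>m n n"
    using assms by (simp add: DCz_def Let_def P_def k_def S_def S\<^sub>0_def dX[unfolded S_def])
  define e where "e = (blk 0 0 (1\<^sub>m n) :: complex seq_endo)"
  define s where "s = blk 0 0 S"
  define s\<^sub>0 where "s\<^sub>0 = blk 0 0 S\<^sub>0"
  define x where "x = blk 0 0 X"
  define t where "t = blk 0 0 T"
  have mult: "blk 0 0 (Y * Z) = blk 0 0 Y * blk 0 0 Z"
    if "Y \<in> carrier_mat n n" "Z \<in> carrier_mat n n" for Y Z :: "complex mat"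
    using that by (rule blk_mult[symmetric])
  have pow: "blk 0 0 (S ^\<^sub>m i) = e * s ^ i" "S ^\<^sub>m i \<in> carrier_mat n n"
    "X ^\<^sub>m i \<in> carrier_mat n n" for i
    using c Xc by (simp_all add: blk_pow[of _ n] s_def e_def)
  have p: "blk 0 0 P = e - s * x"
    using c Xc by (simp add: P_def blk_minus[of _ n n] mult e_def s_def x_def)
  \<comment> \<open>This turns membership in \<open>DCz\<close> into the corner condition on the
    infinitesimal part of A^k.\<close>
  have "blk 0 0 ?Q = t"
    unfolding t_def T_def blk_inf_mat_pow(3)[OF A] using c
    by (subst blk_mat_sum[of _ _ n n]) (auto simp: mult blk_pow[of _ n] e_def S_def S\<^sub>0_def mult_carrier_mat[of _ n n _ n])
  moreover have "blk 0 0 (P * ?Q * P) = 0" by (simp only: PQP blk_zero)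
  ultimately have zero: "(e - s * x) * t * (e - s * x) = 0"
    using Pc Qc by (simp add: mult p mult_carrier_mat[of _ n n _ n] mult.assoc)
  have D: "drazin_wrt e k s x"
    using X is_drazin_inverse_blk[OF c(1) Xc] unfolding e_def s_def x_def by blast
  have corner: "e * s = s" "s * e = s" "e * e = e" "e * t = t" "t * e = t" "e * s\<^sub>0 = s\<^sub>0" "s\<^sub>0 * e = s\<^sub>0"
    "e * x = x"
    using c Tc Xc by (simp_all add: e_def s_def s\<^sub>0_def t_def x_def blk_one_left blk_one_right blk_one_idem)
  note factor = dual_power_factor[OF D corner(1-7) zero]
  have xp: "blk 0 0 (X ^\<^sub>m Suc k) = x ^ Suc k"
    using corner(8) unfolding blk_pow[OF Xc] e_def[symmetric] x_def[symmetric]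
    by (simp add: mult.assoc[symmetric])
  \<comment> \<open>The dual matrices X + \<epsilon> \<open>U\<^sub>0\<close> and X + \<epsilon>
    \<open>W\<^sub>0\<close> will be the right and left factors of A^k through A^(k+1), checked part
    by part.\<close>
  define U\<^sub>0 where "U\<^sub>0 = X ^\<^sub>m Suc k * T * P - X * S\<^sub>0 * X"
  define W\<^sub>0 where "W\<^sub>0 = P * T * X ^\<^sub>m Suc k - X * S\<^sub>0 * X"
  have c': "U\<^sub>0 \<in> carrier_mat n n" "W\<^sub>0 \<in> carrier_mat n n"
    unfolding U\<^sub>0_def W\<^sub>0_def using c Xc Pc Tc pow
    by (simp_all add: minus_carrier_mat mult_carrier_mat[of _ n n _ n] del: pow_mat.simps)
  have u0: "blk 0 0 U\<^sub>0 = x ^ Suc k * t * (e - s * x) - x * s\<^sub>0 * x"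
    and w0: "blk 0 0 W\<^sub>0 = (e - s * x) * t * x ^ Suc k - x * s\<^sub>0 * x"
    unfolding U\<^sub>0_def W\<^sub>0_def using c Xc Pc Tc pow
    by (simp_all add: blk_minus[of _ n n] mult mult_carrier_mat[of _ n n _ n] p xp del: pow_mat.simps)
      (simp_all add: s\<^sub>0_def x_def t_def mult.assoc)
  obtain U where U: "U \<in> carrier_mat n n" "std_mat U = X" "inf_mat U = U\<^sub>0"
    using dc_mat_parts[OF Xc c'(1)] .
  obtain W where W: "W \<in> carrier_mat n n" "std_mat W = X" "inf_mat W = W\<^sub>0"
    using dc_mat_parts[OF Xc c'(2)] .
  have Ac: "A ^\<^sub>m i \<in> carrier_mat n n" for i using A by simp
  have xs: "e * s ^ k = e * s ^ Suc k * x" "e * s ^ k = x * (e * s ^ Suc k)"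
  proof -
    have d: "s * x = x * s" "e * s ^ k * x * s = e * s ^ k" using D by (auto simp: drazin_wrt_def)
    show 1: "e * s ^ k = e * s ^ Suc k * x"
      using d by (simp add: power_Suc2 mult.assoc del: power_Suc)
    have "e * s ^ Suc k = s ^ Suc k" using corner by (simp add: mult.assoc[symmetric])
    then show "e * s ^ k = x * (e * s ^ Suc k)"
      using 1 commuting_power[OF d(1), of "Suc k"] by (simp only:)
  qed
  have eq: "Y = Z" if "blk 0 0 Y = blk 0 0 Z" "Y \<in> carrier_mat n n" "Z \<in> carrier_mat n n"
    for Y Z :: "complex mat"
    using blk_inject that by blast
  have "A ^\<^sub>m k = A ^\<^sub>m Suc k * U"
  proof (rule dc_mat_eqI[of _ n n])
    have "S ^\<^sub>m k = S ^\<^sub>m Suc k * X"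
      by (rule eq) (use c Xc xs(1) in \<open>simp_all add: mult pow x_def mult_carrier_mat[of _ n n _ n] del: pow_mat.simps power_Suc\<close>)
    then show "std_mat (A ^\<^sub>m k) = std_mat (A ^\<^sub>m Suc k * U)"
      using U Ac by (simp add: std_mat_mult[of _ n n _ n] std_mat_pow[OF A] S_def del: pow_mat.simps)
    have "T = S ^\<^sub>m Suc k * U\<^sub>0 + inf_mat (A ^\<^sub>m Suc k) * X"
    proof (rule eq)
      show "blk 0 0 T = blk 0 0 (S ^\<^sub>m Suc k * U\<^sub>0 + inf_mat (A ^\<^sub>m Suc k) * X)"
        using c Xc c' Ac factor(1)[OF blk_inf_mat_pow(1)[OF A, of k, folded S_def S\<^sub>0_def T_def, folded e_def s_def s\<^sub>0_def t_def]]
        by (simp add: blk_add[of _ n n] mult pow u0 mult_carrier_mat[of _ n n _ n] del: pow_mat.simps power_Suc)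
          (simp add: x_def t_def)
    qed (use Tc c c' Xc Ac in \<open>simp_all add: mult_carrier_mat[of _ n n _ n] pow del: pow_mat.simps\<close>)
    then show "inf_mat (A ^\<^sub>m k) = inf_mat (A ^\<^sub>m Suc k * U)"
      using U Ac by (simp add: inf_mat_mult[of _ n n _ n] std_mat_pow[OF A] S_def T_def del: pow_mat.simps)
  qed (use U Ac in \<open>simp_all add: mult_carrier_mat[of _ n n _ n] del: pow_mat.simps\<close>)
  moreover have "A ^\<^sub>m k = W * A ^\<^sub>m Suc k"
  proof (rule dc_mat_eqI[of _ n n])
    have "S ^\<^sub>m k = X * S ^\<^sub>m Suc k"
      by (rule eq) (use c Xc xs(2) in \<open>simp_all add: mult pow x_def mult_carrier_mat[of _ n n _ n] del: pow_mat.simps power_Suc\<close>)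
    then show "std_mat (A ^\<^sub>m k) = std_mat (W * A ^\<^sub>m Suc k)"
      using W Ac by (simp add: std_mat_mult[of _ n n _ n] std_mat_pow[OF A] S_def del: pow_mat.simps)
    have "T = X * inf_mat (A ^\<^sub>m Suc k) + W\<^sub>0 * S ^\<^sub>m Suc k"
    proof (rule eq)
      show "blk 0 0 T = blk 0 0 (X * inf_mat (A ^\<^sub>m Suc k) + W\<^sub>0 * S ^\<^sub>m Suc k)"
        using c Xc c' Ac factor(2)[OF blk_inf_mat_pow(2)[OF A, of k, folded S_def S\<^sub>0_def T_def, folded e_def s_def s\<^sub>0_def t_def]]
        by (simp add: blk_add[of _ n n] mult pow w0 mult_carrier_mat[of _ n n _ n] del: pow_mat.simps power_Suc)
          (simp add: x_def t_def)
    qed (use Tc c c' Xc Ac in \<open>simp_all add: mult_carrier_mat[of _ n n _ n] pow del: pow_mat.simps\<close>)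
    then show "inf_mat (A ^\<^sub>m k) = inf_mat (W * A ^\<^sub>m Suc k)"
      using W Ac by (simp add: inf_mat_mult[of _ n n _ n] std_mat_pow[OF A] S_def T_def del: pow_mat.simps)
  qed (use W Ac in \<open>simp_all add: mult_carrier_mat[of _ n n _ n] del: pow_mat.simps\<close>)
  ultimately have "is_drazin_inverse k A (A ^\<^sub>m k * U ^\<^sub>m Suc k)"
    using is_drazin_inverse_exists[OF A U(1) W(1)] by blast
  then show ?thesis unfolding ind_s_def k_def S_def by blast
qed

section \<open>The block formula\<close>

text \<open>The index k is arbitrary: existence supplies an inverse of index \<open>ind_s A\<close>,
  and uniqueness across indices identifies it with X.\<close>

lemma ddrazin_eqI:
  assumes "A \<in> DCz n" "is_drazin_inverse k A X"
  shows "A\<^sup>D = X"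
proof -
  have A: "A \<in> carrier_mat n n" using assms by (simp add: DCz_def)
  obtain Y where Y: "is_drazin_inverse (ind_s A) A Y" using dual_drazin_exists[OF assms(1)] by blast
  then have "Y = X" using is_drazin_inverse_unique[OF A] assms(2) by blast
  then show ?thesis
    unfolding ddrazin_def using Y is_drazin_inverse_unique[OF A] by blast
qed

lemma is_drazin_inverse_ddrazin:
  assumes "A \<in> DCz n"
  shows "is_drazin_inverse (ind_s A) A (A\<^sup>D)"
  using dual_drazin_exists[OF assms] ddrazin_eqI[OF assms] by metis

theorem theorem3p4:
  fixes A B C M \<Phi> :: dc_mat and m p i_A s :: nat
  assumes "A \<in> carrier_mat m m" and "B \<in> carrier_mat m p" and "C \<in> carrier_mat p m"
    and "M = four_block_mat A B C (0\<^sub>m p p)"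
    and "\<Phi> = B * C"
    and "M \<in> DCz (m + p)" and "A \<in> DCz m" and "\<Phi> \<in> DCz m"
    and "ind_s A = i_A" and "ind_s \<Phi> = s"
    and "A * A\<^sup>\<pi> * B * C = B * C * A * A\<^sup>\<pi>"
    and "B * C * A * A\<^sup>e = 0\<^sub>m m m"
  shows "M\<^sup>D = four_block_mat
    (mat_sum m m (\<lambda>i. A\<^bsup>2 * i + 2 D\<^esup> * \<Phi>\<^sup>\<pi> * \<Phi> ^\<^sub>m i * A) {..<s} - A\<^sup>D * \<Phi>\<^sup>e
      + mat_sum m m (\<lambda>i. A\<^bsup>2 * i + 3 D\<^esup> * \<Phi>\<^sup>\<pi> * \<Phi> ^\<^sub>m (i + 1)) {..<s})
    (mat_sum m p (\<lambda>i. A\<^bsup>2 * i + 2 D\<^esup> * \<Phi>\<^sup>\<pi> * \<Phi> ^\<^sub>m i * B) {..<s} + A\<^sup>\<pi> * \<Phi>\<^sup>D * B)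
    (mat_sum p m (\<lambda>i. C * A\<^bsup>2 * i + 3 D\<^esup> * \<Phi>\<^sup>\<pi> * \<Phi> ^\<^sub>m i * A) {..<s} - C * A\<^bsup>2 D\<^esup> * \<Phi>\<^sup>e
      + mat_sum p m (\<lambda>i. C * A\<^bsup>2 * i + 4 D\<^esup> * \<Phi>\<^sup>\<pi> * \<Phi> ^\<^sub>m (i + 1)) {..<s}
      + C * A\<^sup>\<pi> * \<Phi>\<^sup>D)
    (mat_sum p p (\<lambda>i. C * A\<^bsup>2 * i + 3 D\<^esup> * \<Phi>\<^sup>\<pi> * \<Phi> ^\<^sub>m i * B) {..<s}
      - C * A * A\<^sup>\<pi> * \<Phi>\<^bsup>2 D\<^esup> * B - C * A\<^sup>D * \<Phi>\<^sup>D * B)"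
    (is "_ = four_block_mat ?N11 ?N12 ?N21 ?N22")
proof -
  note c = assms(1-3)
  have \<Phi>c: "\<Phi> \<in> carrier_mat m m" using assms(5) c by simp
  have D: "is_drazin_inverse (ind_s A) A (A\<^sup>D)" and T: "is_drazin_inverse s \<Phi> (\<Phi>\<^sup>D)"
    using is_drazin_inverse_ddrazin assms(7,8,10) by metis+
  then have DT: "A\<^sup>D \<in> carrier_mat m m" "\<Phi>\<^sup>D \<in> carrier_mat m m"
    using c \<Phi>c by (auto simp: is_drazin_inverse_def)
  note mult_c = mult_carrier_mat[of _ m m _ m] mult_carrier_mat[of _ m m _ p]
    mult_carrier_mat[of _ p m _ m] mult_carrier_mat[of _ p m _ p]
  have e_c: "A\<^sup>e \<in> carrier_mat m m" "\<Phi>\<^sup>e \<in> carrier_mat m m"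
    using c \<Phi>c DT by (simp_all add: ddrazin_e_def mult_c)
  have pi_c: "A\<^sup>\<pi> \<in> carrier_mat m m" "\<Phi>\<^sup>\<pi> \<in> carrier_mat m m"
    using c \<Phi>c e_c by (simp_all add: ddrazin_pi_def minus_carrier_mat)
  have pow_c: "A\<^bsup>j D\<^esup> \<in> carrier_mat m m" "\<Phi>\<^bsup>j D\<^esup> \<in> carrier_mat m m"
    "\<Phi> ^\<^sub>m j \<in> carrier_mat m m" for j
    using DT \<Phi>c by (simp_all add: ddrazin_pow_def)
  note carriers = c \<Phi>c DT e_c pi_c pow_c mult_c minus_carrier_mat

  \<comment> \<open>The first m coordinates carry the corner of A, the next p coordinates the zero
    block; each block of M is placed accordingly.\<close>
  define e where "e = (blk 0 0 (1\<^sub>m m) :: complex dual_number seq_endo)"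
  define f where "f = (blk m m (1\<^sub>m p) :: complex dual_number seq_endo)"
  define a where "a = blk 0 0 A"
  define b where "b = blk 0 m B"
  define c' where "c' = blk m 0 C"
  define d where "d = blk 0 0 (A\<^sup>D)"
  define t where "t = blk 0 0 (\<Phi>\<^sup>D)"
  have mult:
    "\<And>X Y :: dc_mat. X \<in> carrier_mat m m \<Longrightarrow> Y \<in> carrier_mat m m \<Longrightarrow> blk 0 0 (X * Y) = blk 0 0 X * blk 0 0 Y"
    "\<And>X Y :: dc_mat. X \<in> carrier_mat m m \<Longrightarrow> Y \<in> carrier_mat m p \<Longrightarrow> blk 0 m (X * Y) = blk 0 0 X * blk 0 m Y"
    "\<And>X Y :: dc_mat. X \<in> carrier_mat p m \<Longrightarrow> Y \<in> carrier_mat m m \<Longrightarrow> blk m 0 (X * Y) = blk m 0 X * blk 0 0 Y"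
    "\<And>X Y :: dc_mat. X \<in> carrier_mat p m \<Longrightarrow> Y \<in> carrier_mat m p \<Longrightarrow> blk m m (X * Y) = blk m 0 X * blk 0 m Y"
    by (simp_all add: blk_mult[of _ m m] blk_mult[of _ p m])
  have bc: "blk 0 0 \<Phi> = b * c'"
    unfolding assms(5) b_def c'_def using c by (simp add: blk_mult[of _ m p])
  have rho: "blk 0 0 (A\<^sup>\<pi>) = e - a * d" and psi: "blk 0 0 (\<Phi>\<^sup>\<pi>) = e - b * c' * t"
    using c \<Phi>c DT e_c(1,2) unfolding ddrazin_pi_def
    by (simp_all add: blk_minus[of _ m m] e_def) (simp_all add: ddrazin_e_def mult bc a_def d_def t_def)
  have core: "blk 0 0 (A\<^sup>e) = a * d" "blk 0 0 (\<Phi>\<^sup>e) = b * c' * t"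
    using c \<Phi>c DT by (simp_all add: ddrazin_e_def mult bc a_def d_def t_def)

  interpret L: anti_triangular e f a b c' d t "ind_s A" s
  proof
    show "e * e = e" "f * f = f" unfolding e_def f_def by (rule blk_one_idem)+
    show "e * f = 0" "f * e = 0"
      unfolding e_def f_def by (rule blk_mult_disjoint[of _ m m _ p p] blk_mult_disjoint[of _ p p _ m m]; simp)+
    show "e * a = a" "a * e = a" "e * b = b" "b * f = b" "f * c' = c'" "c' * e = c'"
      unfolding e_def f_def a_def b_def c'_def using c by (simp_all add: blk_one_left blk_one_right)
    show "drazin_wrt e (ind_s A) a d"
      using D is_drazin_inverse_blk[OF c(1) DT(1)] unfolding e_def a_def d_def by blast
    show "drazin_wrt e s (b * c') t"
      using T is_drazin_inverse_blk[OF \<Phi>c DT(2)] unfolding e_def bc[symmetric] t_def by blast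
    have BC: "A * A\<^sup>\<pi> * B * C = A * A\<^sup>\<pi> * \<Phi>"
      unfolding assms(5) using c pi_c mult_c(1) by (intro assoc_mult_mat[of _ m m _ p _ m]) auto
    have "blk 0 0 (A * A\<^sup>\<pi> * \<Phi>) = blk 0 0 (\<Phi> * A * A\<^sup>\<pi>)" using assms(11) BC unfolding assms(5)[symmetric] by (simp only:)
    then show "a * (e - a * d) * (b * c') = b * c' * a * (e - a * d)"
      by (simp add: carriers mult rho bc a_def[symmetric] del: assoc_mult_mat)
    have "blk 0 0 (\<Phi> * A * A\<^sup>e) = 0" using assms(12) unfolding assms(5)[symmetric] by (simp only: blk_zero)
    then show "b * c' * a * (a * d) = 0"
      by (simp add: carriers mult core bc a_def[symmetric] del: assoc_mult_mat)
  qed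

  \<comment> \<open>For j = 0 the left sides are e, not the unit of the ring; every exponent in the
    formula is positive.\<close>
  have d_pow: "blk 0 0 (A\<^bsup>j D\<^esup>) = d ^ j" and t_pow: "blk 0 0 (\<Phi>\<^bsup>j D\<^esup>) = t ^ j" if "j > 0" for j
  proof -
    have "e * d ^ j = d ^ j" "e * t ^ j = t ^ j"
      using that L.d'(1) L.t'(1) by (cases j; simp add: mult.assoc[symmetric])+
    then show "blk 0 0 (A\<^bsup>j D\<^esup>) = d ^ j" "blk 0 0 (\<Phi>\<^bsup>j D\<^esup>) = t ^ j"
      unfolding ddrazin_pow_def blk_pow[OF DT(1)] blk_pow[OF DT(2)] by (simp_all add: e_def d_def t_def)
  qed
  have psi': "blk 0 0 (\<Phi>\<^sup>\<pi>) = L.\<psi>" and rho': "blk 0 0 (A\<^sup>\<pi>) = L.\<rho>" and phi: "blk 0 0 \<Phi> = L.\<phi>"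
    unfolding psi rho bc L.\<psi>_def L.\<rho>_def L.\<phi>_def by (rule refl)+
  \<comment> \<open>The exponent i = 0 does occur here; the preceding \<psi> absorbs the corner
    unit.\<close>
  have phi_pow: "w * L.\<psi> * blk 0 0 (\<Phi> ^\<^sub>m i) = w * L.\<psi> * L.\<phi> ^ i" for w i
    unfolding blk_pow[OF \<Phi>c] e_def[symmetric] phi
    by (simp add: mult.assoc[symmetric]) (simp add: mult.assoc L.e_psi)
  note blk_simps = blk_mat_sum[of _ _ m m] blk_mat_sum[of _ _ m p] blk_mat_sum[of _ _ p m] blk_mat_sum[of _ _ p p]
    blk_add[of _ m m] blk_add[of _ m p] blk_add[of _ p m] blk_add[of _ p p]
    blk_minus[of _ m m] blk_minus[of _ m p] blk_minus[of _ p m] blk_minus[of _ p p]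
    mult d_pow t_pow psi' rho' phi_pow phi core(2)[folded L.\<phi>_def]
    a_def[symmetric] b_def[symmetric] c'_def[symmetric] d_def[symmetric] t_def[symmetric]
  have sum_c: "mat_sum i j F I \<in> carrier_mat i j" for i j I and F :: "nat \<Rightarrow> dc_mat"
    by (simp add: mat_sum_def)
  have N: "?N11 \<in> carrier_mat m m" "?N12 \<in> carrier_mat m p" "?N21 \<in> carrier_mat p m" "?N22 \<in> carrier_mat p p"
    by (simp_all add: carriers sum_c del: assoc_mult_mat pow_mat.simps)
  have "blk 0 0 ?N11 = L.S 1"
    unfolding L.block_11[symmetric] by (simp add: blk_simps carriers sum_c del: One_nat_def assoc_mult_mat pow_mat.simps power_Suc)
  moreover have "blk 0 m ?N12 = L.y * b"
    unfolding L.block_12[symmetric] by (simp add: blk_simps carriers sum_c del: One_nat_def assoc_mult_mat pow_mat.simps power_Suc)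
  moreover have "blk m 0 ?N21 = c' * L.y"
    unfolding L.block_21[symmetric] by (simp add: blk_simps carriers sum_c del: One_nat_def assoc_mult_mat pow_mat.simps power_Suc)
  moreover have "blk m m ?N22 = c' * L.z * b"
    unfolding L.block_22[symmetric] by (simp add: blk_simps carriers sum_c del: One_nat_def assoc_mult_mat pow_mat.simps power_Suc)
  ultimately have x: "blk 0 0 (four_block_mat ?N11 ?N12 ?N21 ?N22) = L.x"
    unfolding blk_four_block_mat[OF N] L.x_def by simp
  have M: "blk 0 0 M = L.m"
    unfolding assms(4) blk_four_block_mat[OF c zero_carrier_mat] L.m_def by (simp add: a_def b_def c'_def)
  have Mc: "M \<in> carrier_mat (m + p) (m + p)" using assms(6) by (simp add: DCz_def)
  have unit: "blk 0 0 (1\<^sub>m (m + p)) = e + f"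
    unfolding four_block_one_mat[symmetric] e_def f_def
    by (subst blk_four_block_mat[of _ m m _ p _ p]) simp_all
  have "is_drazin_inverse (2 * ind_s A + 2 * s + 3) M (four_block_mat ?N11 ?N12 ?N21 ?N22)"
    unfolding is_drazin_inverse_blk[OF Mc four_block_carrier_mat[OF N(1,4)], where p = 0] unit M x
    by (rule L.drazin_wrt_x)
  then show ?thesis by (rule ddrazin_eqI[OF assms(6)])
qed

end
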